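(* In the OSA scheme with equiprobable rectangular $M_I\times M_Q$ QAM and transmit power $P_0>0$ over Rayleigh fading (i.e. $|h|^2$ has density $e^{-x}$, $x\ge0$), the average symbol error probability of the optimal (maximum a posteriori) detector is $$\begin{aligned}\mathrm{SEP}(P_0)=\;&\Pr\{\mathcal H_0|\hat{\mathcal H}_0\}\Big[\big(2-\tfrac1{M_I}-\tfrac1{M_Q}\big)\big(1-\tfrac1{\beta_{0,0}}\big)\\ &\quad-2\big(1-\tfrac1{M_I}\big)\big(1-\tfrac1{M_Q}\big)\Big(\tfrac{2}{\pi}\tfrac{1}{\beta_{0,0}}\tan^{-1}\big(\tfrac1{\beta_{0,0}}\big)-\tfrac1{\beta_{0,0}}+\tfrac12\Big)\Big]\\ +&\Pr\{\mathcal H_1|\hat{\mathcal H}_0\}\Big[\big(2-\tfrac1{M_I}-\tfrac1{M_Q}\big)\sum_{l=1}^p\lambda_l\big(1-\tfrac1{\beta_{1,0,l}}\big)\\ &\quad-2\big(1-\tfrac1{M_I}\big)\big(1-\tfrac1{M_Q}\big)\sum_{l=1}^p\lambda_l\Big(\tfrac{2}{\pi}\tfrac{1}{\beta_{1,0,l}}\tan^{-1}\big(\tfrac1{\beta_{1,0,l}}\big)-\tfrac1{\beta_{1,0,l}}+\tfrac12\Big)\Big],\end{aligned}$$ where $$\beta_{0,0}=\sqrt{1+\tfrac{2}{3P_0}(M_I^2+M_Q^2-2)\sigma_n^2},\qquad \beta_{1,0,l}=\sqrt{1+\tfrac{2}{3P_0}(M_I^2+M_Q^2-2)(\sigma_l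^2+\sigma_n^2)}.$$
   Context: Setting (cognitive radio with imperfect sensing). The true channel state is $\mathcal H_0$ (primary user idle) or $\mathcal H_1$ (primary user active), with given prior probabilities. The sensing decision is $\hat{\mathcal H}_0$ (idle) or $\hat{\mathcal H}_1$ (busy), with $P_{\rm d}=\Pr\{\hat{\mathcal H}_1|\mathcal H_1\}$ and $P_{\rm f}=\Pr\{\hat{\mathcal H}_1|\mathcal H_0\}$. The posteriors $\Pr\{\mathcal H_j|\hat{\mathcal H}_0\}$ follow by Bayes' rule; assume $\Pr\{\hat{\mathcal H}_0\}>0$. In the opportunistic spectrum access (OSA) scheme the secondary user transmits only under decision $\hat{\mathcal H}_0$, with power $P_0$, and error probabilities are conditional on $\hat{\mathcal H}_0$. Constellation. $M_I,M_Q\ge1$ are integers with $M=M_IM_Q\ge 2$. The transmitted symbol is uniform on the points $s_{n,q}=s_n+js_q$ with $$s_n=(2n+1-M_I)\tfrac{d_{min,0}}{2}\ (0\le n\le M_I-1),\qquad s_q=(2q+1-M_Q)\tfrac{d_{min,0}}{2}\ (0\le q\le M_Q-1),$$ $$d_{min,0}=\sqrt{\tfrac{12P_0}{M_I^2+M_Q^2-2}}.$$ Channel. The received signal is $y=hs+n$ under $\mathcal H_0$ and $y=hs+n+w$ under $\mathcal H_1$. The noise $n$ has density $\frac{1}{2\pi\sigma_n^2}e^{-|n|^2/(2\sigma_n^2)}$ on $\mathbb C$ ($\sigma_n^2>0$). The primary interference $w$ has Gaussian mixture density $\sum_{l=1}^p\frac{\lambda_l}{2\pi\sigma_l^2}e^{-|w|^2/(2\sigma_l^2)}$,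 with $\sigma_l^2>0$, $\lambda_l\ge0$, $\sum_l\lambda_l=1$. The variables $n$ and $w$ are independent of each other. Given the sensing decision and the true state, they are also independent of the transmitted symbol. The fading $h$ is independent of the channel state, sensing decision, transmitted symbol, noise and interference. Detector. Knowing $\hat{\mathcal H}_0$, $h$ and $y$, the receiver outputs a constellation point maximizing $\Pr\{\mathcal H_0|\hat{\mathcal H}_0\}f(y|s,h,\hat{\mathcal H}_0,\mathcal H_0)+\Pr\{\mathcal H_1|\hat{\mathcal H}_0\}f(y|s,h,\hat{\mathcal H}_0,\mathcal H_1)$, where $f(y|s,h,\hat{\mathcal H}_0,\mathcal H_j)$ is the conditional density of $y$. $\mathrm{SEP}(P_0)$ is the probability, given $\hat{\mathcal H}_0$, that the output differs from the transmitted symbol, averaged over symbol, true state and $h$. *)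

theory Defs
  imports "HOL-Probability.Probability"
begin

(* The library's indep_var forces both variables to have the same type; this is the
   same notion for variables of different types. *)
definition indep_rv ::
  "'a measure \<Rightarrow> 'b measure \<Rightarrow> ('a \<Rightarrow> 'b) \<Rightarrow> 'c measure \<Rightarrow> ('a \<Rightarrow> 'c) \<Rightarrow> bool" where
  "indep_rv N K X L Y \<longleftrightarrow>
     X \<in> measurable N K \<and> Y \<in> measurable N L \<and>
     prob_space.indep_set N (sets (vimage_algebra (space N) X K))
                            (sets (vimage_algebra (space N) Y L))"

(* f x y is a (jointly measurable version of the) conditional density, with respect to L,
   of Y given X = x: the pair (X, Y) has density f relative to (law of X) \<Otimes> L. *)
definition has_cond_density ::
  "'a measure \<Rightarrow> 'b measure \<Rightarrow> ('a \<Rightarrow> 'b) \<Rightarrow> 'c measure \<Rightarrow> ('a \<Rightarrow> 'c) \<Rightarrow> ('b \<Rightarrow> 'c \<Rightarrow> real) \<Rightarrow> bool"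
  where
  "has_cond_density N K X L Y f \<longleftrightarrow>
     X \<in> measurable N K \<and> (\<forall>x y. 0 \<le> f x y) \<and>
     distributed N (distr N K X \<Otimes>\<^sub>M L) (\<lambda>\<omega>. (X \<omega>, Y \<omega>)) (\<lambda>z. ennreal (f (fst z) (snd z)))"

(* Total variance is 2 * v: v is the variance of each real component. *)
definition cgauss_density :: "real \<Rightarrow> complex \<Rightarrow> real" where
  "cgauss_density v z = 1 / (2 * pi * v) * exp (- (cmod z)\<^sup>2 / (2 * v))"

definition cgauss_mixture_density ::
  "nat \<Rightarrow> (nat \<Rightarrow> real) \<Rightarrow> (nat \<Rightarrow> real) \<Rightarrow> complex \<Rightarrow> real" where
  "cgauss_mixture_density p lam \<sigma> z = (\<Sum>l=1..p. lam l * cgauss_density ((\<sigma> l)\<^sup>2) z)"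

(* Used both for the true channel state (Idle = H_0, Busy = H_1) and for the decision. *)
datatype channel = Idle | Busy

definition posterior ::
  "'a measure \<Rightarrow> ('a \<Rightarrow> channel) \<Rightarrow> ('a \<Rightarrow> channel) \<Rightarrow> channel \<Rightarrow> real" where
  "posterior M state decision j = \<P>(\<omega> in M. state \<omega> = j \<bar> decision \<omega> = Idle)"

definition detection_prob ::
  "'a measure \<Rightarrow> ('a \<Rightarrow> channel) \<Rightarrow> ('a \<Rightarrow> channel) \<Rightarrow> real" where
  "detection_prob M state decision = \<P>(\<omega> in M. decision \<omega> = Busy \<bar> state \<omega> = Busy)"

definition false_alarm_prob ::
  "'a measure \<Rightarrow> ('a \<Rightarrow> channel) \<Rightarrow> ('a \<Rightarrow> channel) \<Rightarrow> real" where
  "false_alarm_prob M state decision = \<P>(\<omega> in M. decision \<omega> = Busy \<bar> state \<omega> = Idle)"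

lemma posterior_Bayes:
  fixes M :: "'a measure" and state decision :: "'a \<Rightarrow> channel"
  assumes "prob_space M"
    and [measurable]: "state \<in> measurable M (count_space UNIV)"
      "decision \<in> measurable M (count_space UNIV)"
  defines "p0 \<equiv> \<P>(\<omega> in M. state \<omega> = Idle)" and "p1 \<equiv> \<P>(\<omega> in M. state \<omega> = Busy)"
    and "pf \<equiv> false_alarm_prob M state decision" and "pd \<equiv> detection_prob M state decision"
  shows "posterior M state decision Idle = p0 * (1 - pf) / (p0 * (1 - pf) + p1 * (1 - pd))"
    and "posterior M state decision Busy = p1 * (1 - pd) / (p0 * (1 - pf) + p1 * (1 - pd))"
proof -
  interpret prob_space M by fact
  have split: "\<P>(\<omega> in M. state \<omega> = j) =
      \<P>(\<omega> in M. state \<omega> = j \<and> decision \<omega> = Idle) +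
      \<P>(\<omega> in M. decision \<omega> = Busy \<and> state \<omega> = j)" for j
    by (subst finite_measure_Union [symmetric])
       (auto intro!: arg_cong [where f = prob] intro: channel.exhaust)
  have sp: "\<P>(\<omega> in M. decision \<omega> = Idle) =
      \<P>(\<omega> in M. state \<omega> = Idle \<and> decision \<omega> = Idle) +
      \<P>(\<omega> in M. state \<omega> = Busy \<and> decision \<omega> = Idle)"
    by (subst finite_measure_Union [symmetric])
       (auto intro!: arg_cong [where f = prob] intro: channel.exhaust)
  have *: "\<P>(\<omega> in M. state \<omega> = j) * (1 - \<P>(\<omega> in M. decision \<omega> = Busy \<bar> state \<omega> = j)) =
      \<P>(\<omega> in M. state \<omega> = j \<and> decision \<omega> = Idle)" for j
  proof (cases "\<P>(\<omega> in M. state \<omega> = j) = 0")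
    case True
    have "0 \<le> \<P>(\<omega> in M. state \<omega> = j \<and> decision \<omega> = Idle)"
      "0 \<le> \<P>(\<omega> in M. decision \<omega> = Busy \<and> state \<omega> = j)"
      by (rule measure_nonneg)+
    then have "\<P>(\<omega> in M. state \<omega> = j \<and> decision \<omega> = Idle) = 0"
      using True split [of j] by linarith
    then show ?thesis
      unfolding True by simp
  next
    case False
    then show ?thesis
      using split [of j] by (simp add: cond_prob_def field_simps)
  qed
  show "posterior M state decision Idle = p0 * (1 - pf) / (p0 * (1 - pf) + p1 * (1 - pd))"
    and "posterior M state decision Busy = p1 * (1 - pd) / (p0 * (1 - pf) + p1 * (1 - pd))"
    unfolding p0_def p1_def pf_def pd_def detection_prob_def false_alarm_prob_def *
      posterior_def
    by (simp_all add: cond_prob_def sp)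
qed

(* Conditional probability space given an idle decision and true state j; only
   meaningful when that event has positive probability. *)
definition given_idle ::
  "'a measure \<Rightarrow> ('a \<Rightarrow> channel) \<Rightarrow> ('a \<Rightarrow> channel) \<Rightarrow> channel \<Rightarrow> 'a measure" where
  "given_idle M state decision j =
     uniform_measure M {\<omega> \<in> space M. decision \<omega> = Idle \<and> state \<omega> = j}"

definition qam_dmin :: "nat \<Rightarrow> nat \<Rightarrow> real \<Rightarrow> real" where
  "qam_dmin MI MQ P0 = sqrt (12 * P0 / ((real MI)\<^sup>2 + (real MQ)\<^sup>2 - 2))"

definition pam_level :: "nat \<Rightarrow> real \<Rightarrow> nat \<Rightarrow> real" where
  "pam_level m d k = (2 * real k + 1 - real m) * (d / 2)"

definition qam_constellation :: "nat \<Rightarrow> nat \<Rightarrow> real \<Rightarrow> complex set" where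
  "qam_constellation MI MQ P0 =
     {Complex (pam_level MI (qam_dmin MI MQ P0) n) (pam_level MQ (qam_dmin MI MQ P0) q) | n q.
        n < MI \<and> q < MQ}"

(* The secondary user is silent under a Busy decision; the interference w is present
   exactly when the channel is truly Busy. *)
definition osa_received ::
  "('a \<Rightarrow> channel) \<Rightarrow> ('a \<Rightarrow> channel) \<Rightarrow> ('a \<Rightarrow> complex) \<Rightarrow> ('a \<Rightarrow> complex) \<Rightarrow>
   ('a \<Rightarrow> complex) \<Rightarrow> ('a \<Rightarrow> complex) \<Rightarrow> 'a \<Rightarrow> complex" where
  "osa_received state decision S h n w \<omega> =
     (if decision \<omega> = Idle then h \<omega> * S \<omega> else 0) + n \<omega> +
     (if state \<omega> = Busy then w \<omega> else 0)"

(* D maps the fading coefficient h and the received value y to the detected symbol;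
   f j s h y stands for the conditional density of y given s, h, an idle decision and state j. *)
definition is_map_detector ::
  "complex set \<Rightarrow> (channel \<Rightarrow> real) \<Rightarrow> (channel \<Rightarrow> complex \<Rightarrow> complex \<Rightarrow> complex \<Rightarrow> real) \<Rightarrow>
   (complex \<Rightarrow> complex \<Rightarrow> complex) \<Rightarrow> bool" where
  "is_map_detector C post f D \<longleftrightarrow>
     (\<lambda>(h, y). D h y) \<in> borel_measurable (borel \<Otimes>\<^sub>M borel) \<and>
     (\<forall>h y. D h y \<in> C \<and>
        (\<forall>s\<in>C. post Idle * f Idle s h y + post Busy * f Busy s h y
              \<le> post Idle * f Idle (D h y) h y + post Busy * f Busy (D h y) h y))"

definition osa_sep ::
  "'a measure \<Rightarrow> ('a \<Rightarrow> channel) \<Rightarrow> ('a \<Rightarrow> channel) \<Rightarrow> ('a \<Rightarrow> complex) \<Rightarrow> ('a \<Rightarrow> complex) \<Rightarrow>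
   ('a \<Rightarrow> complex) \<Rightarrow> ('a \<Rightarrow> complex) \<Rightarrow> (complex \<Rightarrow> complex \<Rightarrow> complex) \<Rightarrow> real" where
  "osa_sep M state decision S h n w D =
     \<P>(\<omega> in M. D (h \<omega>) (osa_received state decision S h n w \<omega>) \<noteq> S \<omega> \<bar> decision \<omega> = Idle)"

definition qam_beta :: "nat \<Rightarrow> nat \<Rightarrow> real \<Rightarrow> real \<Rightarrow> real" where
  "qam_beta MI MQ P0 v = sqrt (1 + 2 / (3 * P0) * ((real MI)\<^sup>2 + (real MQ)\<^sup>2 - 2) * v)"

end

(* Given the fading coefficient g and one true state, the received value has the radially
   decreasing density k (y - g * s), a Gaussian mixture; so, up to null sets, the MAP detector
   picks the constellation point s with g * s nearest to y. By rotation invariance the decision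
   regions become axis-parallel cells, and the probability of a correct decision is a polynomial
   in the Gaussian tail Q. With X = |g|^2 exponential, E Q(c sqrt X) and E Q(c sqrt X)^2 are the
   probabilities that X lies below t^2 / c^2, respectively below min(t, u)^2 / c^2, for independent
   positive Gaussian t, u; integrating over X first makes them elementary. *)

theory Submission
  imports Defs
begin

subsection \<open>Gaussian tails averaged over an exponential variable\<close>

text \<open>The functions \<open>f j\<close> are arbitrary versions of conditional densities, fixed
  only up to null sets, and \<open>D\<close> may do anything on such sets. The geometry thus becomes
  available only after \<open>f j s g y = k (y - g * s)\<close> is known for almost all
  \<open>g\<close> and \<open>y\<close>. This works for each fixed \<open>s\<close> because every
  symbol is an atom of positive probability, and the finite constellation keeps the union of
  exceptional sets null. Ties and \<open>g = 0\<close> are null as well. In both true states the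
  density decreases strictly in the same distance |y - g s|, so the posterior weights shape the
  score but not the decision regions. A state of posterior zero comes with no hypotheses; its
  statements carry the factor zero. Origin of the constants: with
  \<open>\<kappa> = qam_dmin / 2\<close> and variance v per coordinate, averaging over the fading
  turns the exponent t^2/(2v) into t^2/(2v) + t^2/\<kappa>^2, that is, multiplies it by \<beta>^2 =
  1 + 2v/\<kappa>^2. The arctangent measures the part u > t of the positive quadrant: along u = t s
  the integral over t leaves a multiple of 1/(\<beta>^2 + s^2) for s > 1.\<close>

lemma pred_greaterThan [measurable (raw)]:
  fixes f g :: "'a \<Rightarrow> real"
  assumes [measurable]: "f \<in> borel_measurable M" "g \<in> borel_measurable M"
  shows "Measurable.pred M (\<lambda>x. f x \<in> {g x<..})"
  by simp

text \<open>For \<open>0 < \<sigma>\<close> this is Q(c / \<sigma>), where Q is the standard normal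
  tail function.\<close>

definition gauss_tail :: "real \<Rightarrow> real \<Rightarrow> real" where
  "gauss_tail \<sigma> c = measure (density lborel (normal_density 0 \<sigma>)) {c<..}"

lemma emeasure_gauss_tail:
  assumes "0 < \<sigma>"
  shows "(\<integral>\<^sup>+t. ennreal (normal_density 0 \<sigma> t) * indicator {c<..} t \<partial>lborel)
    = ennreal (gauss_tail \<sigma> c)"
proof -
  interpret prob_space "density lborel (normal_density 0 \<sigma>)"
    by (rule prob_space_normal_density) fact
  show ?thesis
    unfolding gauss_tail_def emeasure_eq_measure[symmetric]
    by (subst emeasure_density) auto
qed

lemma gauss_tail_bounds:
  assumes "0 < \<sigma>"
  shows "0 \<le> gauss_tail \<sigma> c" "gauss_tail \<sigma> c \<le> 1"
proof -
  interpret prob_space "density lborel (normal_density 0 \<sigma>)"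
    by (rule prob_space_normal_density) fact
  show "0 \<le> gauss_tail \<sigma> c" "gauss_tail \<sigma> c \<le> 1"
    by (auto simp: gauss_tail_def)
qed

text \<open>For \<open>0 < t\<close> and X exponential with mean 1, the left side is the probability
  of X < t^2 / \<kappa>^2; for \<open>t \<le> 0\<close> the event is empty.\<close>

lemma exponential_sqrt_less:
  assumes "0 < \<kappa>"
  shows "(\<integral>\<^sup>+x. ennreal (exponential_density 1 x) * indicator {\<kappa> * sqrt x<..} t \<partial>lborel)
    = ennreal (1 - exp (- t\<^sup>2 / \<kappa>\<^sup>2)) * indicator {0<..} t"
proof (cases "0 < t")
  case True
  have *: "\<kappa> * sqrt x < t \<longleftrightarrow> x < t\<^sup>2 / \<kappa>\<^sup>2" if "0 \<le> x" for x
  proof -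
    have "\<kappa> * sqrt x < t \<longleftrightarrow> sqrt x < t / \<kappa>"
      using assms by (simp add: field_simps)
    also have "\<dots> \<longleftrightarrow> sqrt x < sqrt ((t / \<kappa>)\<^sup>2)"
      using assms True by simp
    finally show ?thesis
      by (simp add: power_divide)
  qed
  have "(\<integral>\<^sup>+x. ennreal (exponential_density 1 x) * indicator {\<kappa> * sqrt x<..} t \<partial>lborel)
      = (\<integral>\<^sup>+x. ennreal (exponential_density 1 x) * indicator {..t\<^sup>2 / \<kappa>\<^sup>2} x \<partial>lborel)"
    using AE_lborel_singleton[of "t\<^sup>2 / \<kappa>\<^sup>2"]
    by (intro nn_integral_cong_AE, eventually_elim)
       (auto simp: exponential_density_def * split: split_indicator)
  also have "\<dots> = ennreal (erlang_CDF 0 1 (t\<^sup>2 / \<kappa>\<^sup>2))"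
    by (subst emeasure_erlang_density[symmetric]) (auto simp: emeasure_density)
  finally show ?thesis
    using True by (simp add: erlang_CDF_0)
next
  case False
  have "\<not> \<kappa> * sqrt x < t" if "0 \<le> x" for x
    using that assms False by (meson less_le_not_le mult_nonneg_nonneg order.trans linorder_not_less real_sqrt_ge_zero)
  then show ?thesis
    using False by (auto intro!: nn_integral_zero' AE_I2 simp: exponential_density_def split: split_indicator)
qed

text \<open>The exponents combine to -\<beta>^2 t^2 / (2 \<sigma>^2): damping narrows the Gaussian
  by the factor \<beta>, so its half mass 1/2 shrinks to 1/(2 \<beta>).\<close>

lemma half_gaussian:
  assumes "0 < \<sigma>" "0 \<le> b"
  defines "\<beta> \<equiv> sqrt (1 + 2 * \<sigma>\<^sup>2 * b)"
  shows "(\<integral>\<^sup>+t. ennreal (normal_density 0 \<sigma> t * exp (- b * t\<^sup>2)) * indicator {0<..} t \<partial>lborel)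
    = ennreal (1 / (2 * \<beta>))"
proof -
  have \<beta>: "0 < \<beta>" "\<beta>\<^sup>2 = 1 + 2 * \<sigma>\<^sup>2 * b"
    using assms by (auto simp: \<beta>_def add_pos_nonneg)
  \<comment> \<open>The scale for which the combined exponent at \<open>c * t\<close> is exactly
    -t^2.\<close>
  define c where "c = \<sigma> * sqrt 2 / \<beta>"
  have c: "0 < c" using assms \<beta> by (auto simp: c_def)
  have c2: "c\<^sup>2 * \<beta>\<^sup>2 = 2 * \<sigma>\<^sup>2"
    using \<beta>(1) by (simp add: c_def power_divide power_mult_distrib)
  have e: "normal_density 0 \<sigma> (0 + c * t) * exp (- b * (0 + c * t)\<^sup>2) = exp (- t\<^sup>2) / sqrt (2 * pi * \<sigma>\<^sup>2)" for t
  proof -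
    have "- (c*t)\<^sup>2 / (2 * \<sigma>\<^sup>2) + - b * (c*t)\<^sup>2 = - (c\<^sup>2 * t\<^sup>2 * (1 + 2 * \<sigma>\<^sup>2 * b)) / (2 * \<sigma>\<^sup>2)"
      using assms by (simp add: field_simps power_mult_distrib)
    also have "\<dots> = - t\<^sup>2 * (c\<^sup>2 * \<beta>\<^sup>2) / (2 * \<sigma>\<^sup>2)"
      by (simp add: \<beta>)
    also have "\<dots> = - t\<^sup>2"
      using assms(1) by (simp add: c2)
    finally show ?thesis
      by (simp add: normal_density_def exp_add[symmetric] )
  qed
  have i: "indicator {0<..} (0 + c * t) = (indicator {0<..} t :: ennreal)" for t
    using c by (auto simp: zero_less_mult_iff split: split_indicator)
  have g: "(\<integral>\<^sup>+t. ennreal (exp (- t\<^sup>2)) * indicator {0<..} t \<partial>lborel) = ennreal (sqrt pi / 2)"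
  proof -
    have "(\<integral>\<^sup>+t. ennreal (exp (- t\<^sup>2)) * indicator {0<..} t \<partial>lborel) =
       (\<integral>\<^sup>+t. ennreal (indicator {0..} t *\<^sub>R exp (- t\<^sup>2)) \<partial>lborel)"
      using AE_lborel_singleton[of 0]
      by (intro nn_integral_cong_AE, eventually_elim) (auto split: split_indicator)
    also have "\<dots> = ennreal (sqrt pi / 2)"
      using gaussian_moment_0
      by (subst nn_integral_eq_integral) (auto simp: has_bochner_integral_iff)
    finally show ?thesis .
  qed
  have "(\<integral>\<^sup>+t. ennreal (normal_density 0 \<sigma> t * exp (- b * t\<^sup>2)) * indicator {0<..} t \<partial>lborel)
    = ennreal c * (\<integral>\<^sup>+t. ennreal (exp (- t\<^sup>2) / sqrt (2 * pi * \<sigma>\<^sup>2)) * indicator {0<..} t \<partial>lborel)"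
    using c by (subst nn_integral_real_affine[where c=c and t=0]) (simp_all only: e i abs_of_pos, measurable)
  also have "\<dots> = ennreal c * (ennreal (1 / sqrt (2 * pi * \<sigma>\<^sup>2)) * ennreal (sqrt pi / 2))"
    unfolding g[symmetric]
    by (subst nn_integral_cmult[symmetric])
       (auto intro!: nn_integral_cong arg_cong[where f="(*) (ennreal c)"] simp: ennreal_mult'[symmetric] mult.assoc[symmetric])
  also have "\<dots> = ennreal (1 / (2 * \<beta>))"
    using c assms \<beta>(1) by (simp add: ennreal_mult'[symmetric] c_def real_sqrt_mult field_simps)
  finally show ?thesis .
qed

lemma half_gaussian_0:
  assumes "0 < \<sigma>"
  shows "(\<integral>\<^sup>+t. ennreal (normal_density 0 \<sigma> t) * indicator {0<..} t \<partial>lborel) = ennreal (1 / 2)"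
  using half_gaussian[OF assms, of 0] by simp

lemma borel_measurable_gauss_tail [measurable]:
  assumes "0 < \<sigma>" shows "gauss_tail \<sigma> \<in> borel_measurable borel"
proof -
  have "gauss_tail \<sigma> = (\<lambda>c. enn2real (\<integral>\<^sup>+t. ennreal (normal_density 0 \<sigma> t) * indicator {c<..} t \<partial>lborel))"
    by (simp add: emeasure_gauss_tail assms gauss_tail_bounds)
  \<comment> \<open>\<open>pred_greaterThan\<close> makes the half-line measurable jointly in its
    endpoint \<open>c\<close> and in \<open>t\<close>.\<close>
  also have "\<dots> \<in> borel_measurable borel"
    by measurable
  finally show ?thesis .
qed

text \<open>Subtraction on \<open>ennreal\<close> is truncated, so integrals of
  \<open>1 - exp ...\<close> are found by adding the complementary integral and solving for the
  unknown one.\<close>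

lemma ennreal_eq_diffI:
  assumes "a + ennreal b = ennreal c" "0 \<le> b"
  shows "a = ennreal (c - b)"
proof -
  have "a = a + ennreal b - ennreal b" by simp
  also have "\<dots> = ennreal (c - b)" using assms by (simp add: ennreal_minus)
  finally show ?thesis .
qed

lemma ennreal_mult_complement:
  assumes "0 \<le> n" "0 \<le> e" "e \<le> (1::real)"
  shows "ennreal (n * (1 - e)) + ennreal (n * e) = ennreal n"
proof -
  have "ennreal (n * (1 - e)) + ennreal (n * e) = ennreal (n * (1 - e) + n * e)"
    using assms by (intro ennreal_plus[symmetric]) auto
  then show ?thesis by (simp add: algebra_simps)
qed

text \<open>With \<open>x\<close> integrated out, the mass of 1 - exp (-t^2/\<kappa>^2) on the
  positive half of the Gaussian remains: 1/2 minus the value of \<open>half_gaussian\<close> for b =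
  1/\<kappa>^2, which is where this \<beta> comes from.\<close>

lemma rayleigh_gauss_tail:
  assumes "0 < \<sigma>" "0 < \<kappa>"
  defines "\<beta> \<equiv> sqrt (1 + 2 * \<sigma>\<^sup>2 / \<kappa>\<^sup>2)"
  shows "(\<integral>\<^sup>+x. ennreal (exponential_density 1 x) * ennreal (gauss_tail \<sigma> (\<kappa> * sqrt x)) \<partial>lborel)
    = ennreal ((1 - 1 / \<beta>) / 2)"
proof -
  have "(\<integral>\<^sup>+x. ennreal (exponential_density 1 x) * ennreal (gauss_tail \<sigma> (\<kappa> * sqrt x)) \<partial>lborel)
    = (\<integral>\<^sup>+x. \<integral>\<^sup>+t. ennreal (normal_density 0 \<sigma> t) * (ennreal (exponential_density 1 x) * indicator {\<kappa> * sqrt x<..} t) \<partial>lborel \<partial>lborel)"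
    by (auto simp: emeasure_gauss_tail[OF assms(1), symmetric] nn_integral_cmult[symmetric] ac_simps
        intro!: nn_integral_cong)
  also have "\<dots> = (\<integral>\<^sup>+t. \<integral>\<^sup>+x. ennreal (normal_density 0 \<sigma> t) * (ennreal (exponential_density 1 x) * indicator {\<kappa> * sqrt x<..} t) \<partial>lborel \<partial>lborel)"
    by (rule lborel_pair.Fubini') measurable
  also have "\<dots> = (\<integral>\<^sup>+t. ennreal (normal_density 0 \<sigma> t) * (ennreal (1 - exp (- t\<^sup>2 / \<kappa>\<^sup>2)) * indicator {0<..} t) \<partial>lborel)" (is "_ = ?A")
    by (auto simp: nn_integral_cmult exponential_sqrt_less[OF assms(2)] intro!: nn_integral_cong)
  finally have eq: "(\<integral>\<^sup>+x. ennreal (exponential_density 1 x) * ennreal (gauss_tail \<sigma> (\<kappa> * sqrt x)) \<partial>lborel) = ?A" .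
  have "?A + ennreal (1 / (2 * \<beta>)) =
    (\<integral>\<^sup>+t. ennreal (normal_density 0 \<sigma> t) * (ennreal (1 - exp (- t\<^sup>2 / \<kappa>\<^sup>2)) * indicator {0<..} t)
       + ennreal (normal_density 0 \<sigma> t * exp (- (1/\<kappa>\<^sup>2) * t\<^sup>2)) * indicator {0<..} t \<partial>lborel)"
    using half_gaussian[OF assms(1), of "1/\<kappa>\<^sup>2"] by (subst nn_integral_add) (auto simp: \<beta>_def)
  also have "\<dots> = (\<integral>\<^sup>+t. ennreal (normal_density 0 \<sigma> t) * indicator {0<..} t \<partial>lborel)"
  proof (intro nn_integral_cong)
    fix t :: real
    have "ennreal (normal_density 0 \<sigma> t * (1 - exp (- t\<^sup>2 / \<kappa>\<^sup>2))) + ennreal (normal_density 0 \<sigma> t * exp (- t\<^sup>2 / \<kappa>\<^sup>2))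
        = ennreal (normal_density 0 \<sigma> t)"
      by (rule ennreal_mult_complement) auto
    then show "ennreal (normal_density 0 \<sigma> t) * (ennreal (1 - exp (- t\<^sup>2 / \<kappa>\<^sup>2)) * indicator {0<..} t)
       + ennreal (normal_density 0 \<sigma> t * exp (- (1/\<kappa>\<^sup>2) * t\<^sup>2)) * indicator {0<..} t
      = ennreal (normal_density 0 \<sigma> t) * indicator {0<..} t"
      by (simp add: ennreal_mult' split: split_indicator)
  qed
  also have "\<dots> = ennreal (1/2)" by (rule half_gaussian_0) fact
  finally have "?A + ennreal (1 / (2 * \<beta>)) = ennreal (1/2)" .
  then have "?A = ennreal (1/2 - 1 / (2 * \<beta>))"
    by (rule ennreal_eq_diffI) (simp add: \<beta>_def)
  then show ?thesis unfolding eq by (simp add: diff_divide_distrib mult.commute)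
qed

text \<open>The factor \<open>t\<close> is the Jacobian of the substitution \<open>u = t * s\<close>
  made in \<open>rayleigh_gauss_tail_square\<close>; it gives the integrand an elementary
  antiderivative.\<close>

lemma half_line_linear_gaussian:
  assumes "0 < c"
  shows "(\<integral>\<^sup>+t. ennreal (t * exp (- c * t\<^sup>2)) * indicator {0<..} t \<partial>lborel) = ennreal (1 / (2 * c))"
proof -
  have "(\<integral>\<^sup>+t. ennreal (t * exp (- c * t\<^sup>2)) * indicator {0<..} t \<partial>lborel)
    = (\<integral>\<^sup>+t. ennreal (t * exp (- c * t\<^sup>2)) * indicator {0..} t \<partial>lborel)"
    by (intro nn_integral_cong) (auto split: split_indicator)
  also have "\<dots> = ennreal (0 - - 1 / (2 * c) * exp (- c * 0\<^sup>2))"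
  proof (rule nn_integral_FTC_atLeast)
    have "filterlim (\<lambda>t. - c * t\<^sup>2) at_bot at_top"
      using assms by (intro filterlim_tendsto_neg_mult_at_bot[OF tendsto_const] filterlim_pow_at_top filterlim_ident) auto
    then have "((\<lambda>t. exp (- c * t\<^sup>2)) \<longlongrightarrow> 0) at_top"
      by (rule filterlim_compose[OF exp_at_bot])
    then show "((\<lambda>t. - 1 / (2 * c) * exp (- c * t\<^sup>2)) \<longlongrightarrow> 0) at_top"
      by (rule tendsto_mult_right_zero)
    show "((\<lambda>t. - 1 / (2 * c) * exp (- c * t\<^sup>2)) has_real_derivative x * exp (- c * x\<^sup>2)) (at x)" for x
      using assms by (auto intro!: derivative_eq_intros simp: field_simps)
  qed auto
  finally show ?thesis by simp
qed

text \<open>The antiderivative is \<open>arctan (s / \<beta>) / \<beta>\<close>. The lower limit 1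
  is the diagonal u = t in the coordinate s = u / t.\<close>

lemma nn_integral_inverse_sum_squares:
  assumes "0 < (\<beta>::real)"
  shows "(\<integral>\<^sup>+s. ennreal (1 / (\<beta>\<^sup>2 + s\<^sup>2)) * indicator {1..} s \<partial>lborel)
    = ennreal ((pi / 2 - arctan (1 / \<beta>)) / \<beta>)"
proof -
  have "(\<integral>\<^sup>+s. ennreal (1 / (\<beta>\<^sup>2 + s\<^sup>2)) * indicator {1..} s \<partial>lborel)
    = ennreal (pi / 2 / \<beta> - arctan (1 / \<beta>) / \<beta>)"
  proof (rule nn_integral_FTC_atLeast)
    have "filterlim (\<lambda>s. s / \<beta>) at_top at_top"
      using filterlim_tendsto_pos_mult_at_top[OF tendsto_const[of "1 / \<beta>"] _ filterlim_ident] assms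
      by simp
    then have "((\<lambda>s. arctan (s / \<beta>)) \<longlongrightarrow> pi / 2) at_top"
      by (rule filterlim_compose[OF tendsto_arctan_at_top])
    then show "((\<lambda>s. arctan (s / \<beta>) / \<beta>) \<longlongrightarrow> pi / 2 / \<beta>) at_top"
      using assms by (intro tendsto_divide tendsto_const) auto
    show "((\<lambda>s. arctan (s / \<beta>) / \<beta>) has_real_derivative 1 / (\<beta>\<^sup>2 + x\<^sup>2)) (at x)" for x
    proof -
      have "\<beta>\<^sup>2 + x\<^sup>2 = \<beta> * \<beta> * (1 + (x / \<beta>)\<^sup>2)"
        using assms by (simp add: power_divide distrib_left power2_eq_square)
      then show ?thesis
        using assms by (auto intro!: derivative_eq_intros simp: divide_simps)
    qed
  qed (auto)
  then show ?thesis by (simp add: diff_divide_distrib)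
qed

text \<open>Two Gaussians both exceed a level exactly when their minimum does. After
  \<open>x\<close> is integrated out, the value is the quadrant mass 1/4 minus that of exp
  (-min(t,u)^2/\<kappa>^2). The second claim is needed to return from \<open>ennreal\<close> to real
  moments, since the sign of the closed form is not evident.\<close>

lemma rayleigh_gauss_tail_square:
  assumes "0 < \<sigma>" "0 < \<kappa>"
  defines "\<beta> \<equiv> sqrt (1 + 2 * \<sigma>\<^sup>2 / \<kappa>\<^sup>2)"
  shows "(\<integral>\<^sup>+x. ennreal (exponential_density 1 x) * ennreal ((gauss_tail \<sigma> (\<kappa> * sqrt x))\<^sup>2) \<partial>lborel)
    = ennreal ((2 / pi * (1 / \<beta>) * arctan (1 / \<beta>) - 1 / \<beta> + 1 / 2) / 2)"
    and "0 \<le> (2 / pi * (1 / \<beta>) * arctan (1 / \<beta>) - 1 / \<beta> + 1 / 2) / 2"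
proof -
  have \<beta>: "0 < \<beta>" "\<beta>\<^sup>2 = 1 + 2 * \<sigma>\<^sup>2 / \<kappa>\<^sup>2"
    using assms by (auto simp: \<beta>_def add_pos_nonneg)
  define N where "N = normal_density 0 \<sigma>"
  have N0: "0 \<le> N t" for t by (simp add: N_def)
  have [measurable]: "N \<in> borel_measurable borel" by (simp add: N_def)
  define E where "E t = exp (- t\<^sup>2 / \<kappa>\<^sup>2)" for t
  have E01: "0 \<le> E t" "E t \<le> 1" for t by (auto simp: E_def)
  have [measurable]: "E \<in> borel_measurable borel" unfolding E_def[abs_def] by measurable
  define I where "I t = (indicator {0<..} t :: ennreal)" for t :: real
  have [measurable]: "I \<in> borel_measurable borel" unfolding I_def[abs_def] by measurable
  define A where "A = (\<integral>\<^sup>+x. ennreal (exponential_density 1 x) * ennreal ((gauss_tail \<sigma> (\<kappa> * sqrt x))\<^sup>2) \<partial>lborel)"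
  define K where "K t u = ennreal (N t * N u * E (min t u)) * I t * I u" for t u
  have [measurable]: "(\<lambda>x. K (f x) (g x)) \<in> borel_measurable M"
    if [measurable]: "f \<in> borel_measurable M" "g \<in> borel_measurable M" for f g and M :: "'a measure"
    unfolding K_def by measurable
  have half: "(\<integral>\<^sup>+t. ennreal (N t) * I t \<partial>lborel) = ennreal (1/2)"
    unfolding N_def I_def by (rule half_gaussian_0) fact
  have "A = (\<integral>\<^sup>+x. \<integral>\<^sup>+t. \<integral>\<^sup>+u. ennreal (N t * N u) * (ennreal (exponential_density 1 x) * indicator {\<kappa> * sqrt x<..} (min t u)) \<partial>lborel \<partial>lborel \<partial>lborel)"
    unfolding A_def
  proof (intro nn_integral_cong)
    fix x :: real
    let ?c = "\<kappa> * sqrt x"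
    have "(\<integral>\<^sup>+t. \<integral>\<^sup>+u. ennreal (N t * N u) * (ennreal (exponential_density 1 x) * indicator {?c<..} (min t u)) \<partial>lborel \<partial>lborel)
      = (\<integral>\<^sup>+t. \<integral>\<^sup>+u. ennreal (exponential_density 1 x) * (ennreal (N t) * indicator {?c<..} t) * (ennreal (N u) * indicator {?c<..} u) \<partial>lborel \<partial>lborel)"
      by (intro nn_integral_cong) (auto split: split_indicator simp: ennreal_mult N0 ac_simps)
    also have "\<dots> = ennreal (exponential_density 1 x) * ennreal (gauss_tail \<sigma> ?c) * ennreal (gauss_tail \<sigma> ?c)"
      unfolding N_def by (simp add: nn_integral_cmult nn_integral_multc emeasure_gauss_tail assms)
    finally show "ennreal (exponential_density 1 x) * ennreal ((gauss_tail \<sigma> ?c)\<^sup>2) = (\<integral>\<^sup>+t. \<integral>\<^sup>+u. ennreal (N t * N u) * (ennreal (exponential_density 1 x) * indicator {?c<..} (min t u)) \<partial>lborel \<partial>lborel)"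
      using gauss_tail_bounds[OF assms(1), of ?c] by (simp add: power2_eq_square ennreal_mult mult.assoc)
  qed
  also have "\<dots> = (\<integral>\<^sup>+t. \<integral>\<^sup>+x. \<integral>\<^sup>+u. ennreal (N t * N u) * (ennreal (exponential_density 1 x) * indicator {\<kappa> * sqrt x<..} (min t u)) \<partial>lborel \<partial>lborel \<partial>lborel)"
    by (rule lborel_pair.Fubini') measurable
  also have "\<dots> = (\<integral>\<^sup>+t. \<integral>\<^sup>+u. \<integral>\<^sup>+x. ennreal (N t * N u) * (ennreal (exponential_density 1 x) * indicator {\<kappa> * sqrt x<..} (min t u)) \<partial>lborel \<partial>lborel \<partial>lborel)"
    by (intro nn_integral_cong lborel_pair.Fubini') measurable
  also have "\<dots> = (\<integral>\<^sup>+t. \<integral>\<^sup>+u. ennreal (N t * N u * (1 - E (min t u))) * I t * I u \<partial>lborel \<partial>lborel)"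
  proof (intro nn_integral_cong)
    fix t u :: real
    have "(\<integral>\<^sup>+x. ennreal (N t * N u) * (ennreal (exponential_density 1 x) * indicator {\<kappa> * sqrt x<..} (min t u)) \<partial>lborel)
      = ennreal (N t * N u) * (ennreal (1 - E (min t u)) * indicator {0<..} (min t u))"
      by (simp add: nn_integral_cmult exponential_sqrt_less[OF assms(2)] E_def)
    also have "\<dots> = ennreal (N t * N u * (1 - E (min t u))) * I t * I u"
      using E01 N0 by (auto simp: I_def ennreal_mult'[symmetric] split: split_indicator)
    finally show "(\<integral>\<^sup>+x. ennreal (N t * N u) * (ennreal (exponential_density 1 x) * indicator {\<kappa> * sqrt x<..} (min t u)) \<partial>lborel) = \<dots>" .
  qed
  finally have A: "A = \<dots>" .
  \<comment> \<open>Adding the integral of \<open>K\<close> completes \<open>1 - E\<close> to 1 and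
    leaves the mass 1/4 of the positive quadrant.\<close>
  have "A + (\<integral>\<^sup>+t. \<integral>\<^sup>+u. K t u \<partial>lborel \<partial>lborel)
      = (\<integral>\<^sup>+t. \<integral>\<^sup>+u. ennreal (N t * N u * (1 - E (min t u))) * I t * I u + K t u \<partial>lborel \<partial>lborel)"
    unfolding A by (simp add: nn_integral_add)
  also have "\<dots> = (\<integral>\<^sup>+t. \<integral>\<^sup>+u. (ennreal (N t) * I t) * (ennreal (N u) * I u) \<partial>lborel \<partial>lborel)"
    using E01 N0 unfolding K_def
    by (intro nn_integral_cong)
       (auto simp: I_def ennreal_mult'[symmetric] ennreal_mult_complement split: split_indicator)
  also have "\<dots> = ennreal (1/4)"
    by (simp add: nn_integral_cmult nn_integral_multc half ennreal_mult'[symmetric] del: ennreal_half)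
  finally have sum: "A + (\<integral>\<^sup>+t. \<integral>\<^sup>+u. K t u \<partial>lborel \<partial>lborel) = ennreal (1/4)" .

  \<comment> \<open>On \<open>t < u\<close> the minimum is \<open>t\<close>, so the weight becomes
    \<open>E t\<close>; symmetry of \<open>K\<close> makes the other half equal to \<open>L\<close>,
    and the diagonal is null.\<close>
  define L where "L = (\<integral>\<^sup>+t. \<integral>\<^sup>+u. K t u * indicator {t<..} u \<partial>lborel \<partial>lborel)"
  have "(\<integral>\<^sup>+t. \<integral>\<^sup>+u. K t u \<partial>lborel \<partial>lborel)
    = (\<integral>\<^sup>+t. \<integral>\<^sup>+u. K t u * indicator {t<..} u + K u t * indicator {u<..} t \<partial>lborel \<partial>lborel)"
  proof (rule nn_integral_cong)
    fix t :: real
    show "(\<integral>\<^sup>+u. K t u \<partial>lborel) = (\<integral>\<^sup>+u. K t u * indicator {t<..} u + K u t * indicator {u<..} t \<partial>lborel)"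
      using AE_lborel_singleton[of t]
      by (intro nn_integral_cong_AE, eventually_elim) (auto simp: K_def ac_simps min.commute split: split_indicator)
  qed
  also have "\<dots> = L + (\<integral>\<^sup>+t. \<integral>\<^sup>+u. K u t * indicator {u<..} t \<partial>lborel \<partial>lborel)"
    by (simp add: nn_integral_add L_def)
  also have "(\<integral>\<^sup>+t. \<integral>\<^sup>+u. K u t * indicator {u<..} t \<partial>lborel \<partial>lborel) = L"
    unfolding L_def by (rule lborel_pair.Fubini') measurable
  finally have KL: "(\<integral>\<^sup>+t. \<integral>\<^sup>+u. K t u \<partial>lborel \<partial>lborel) = L + L" .

  \<comment> \<open>Along \<open>u = t * s\<close> all three exponents are multiples of t^2; the
    terms without \<open>s\<close> collect into \<beta>^2.\<close>
  have NE: "t * N t * N (t * s) * E t = 1 / (2 * pi * \<sigma>\<^sup>2) * (t * exp (- ((\<beta>\<^sup>2 + s\<^sup>2) / (2 * \<sigma>\<^sup>2)) * t\<^sup>2))" for t s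
  proof -
    have "- t\<^sup>2 / (2 * \<sigma>\<^sup>2) + - (t * s)\<^sup>2 / (2 * \<sigma>\<^sup>2) + - t\<^sup>2 / \<kappa>\<^sup>2 = - ((\<beta>\<^sup>2 + s\<^sup>2) / (2 * \<sigma>\<^sup>2)) * t\<^sup>2"
      using assms unfolding \<beta> by (simp add: field_simps power_mult_distrib)
    then show ?thesis
      unfolding N_def E_def normal_density_def by (simp add: exp_add[symmetric])
  qed
  \<comment> \<open>Substituting \<open>u = t * s\<close> makes the inner integral over \<open>t\<close> elementary.\<close>
  have "L = (\<integral>\<^sup>+t. \<integral>\<^sup>+s. ennreal (t * N t * N (t * s) * E t) * I t * indicator {1..} s \<partial>lborel \<partial>lborel)"
    unfolding L_def
  proof (rule nn_integral_cong)
    fix t :: real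
    show "(\<integral>\<^sup>+u. K t u * indicator {t<..} u \<partial>lborel)
      = (\<integral>\<^sup>+s. ennreal (t * N t * N (t * s) * E t) * I t * indicator {1..} s \<partial>lborel)"
    proof (cases "0 < t")
      case True
      have "(\<integral>\<^sup>+u. K t u * indicator {t<..} u \<partial>lborel) = (\<integral>\<^sup>+s. ennreal t * (K t (0 + t * s) * indicator {t<..} (0 + t * s)) \<partial>lborel)"
        using True by (subst nn_integral_real_affine[where c=t and t=0]) (auto simp: nn_integral_cmult)
      also have "\<dots> = (\<integral>\<^sup>+s. ennreal (t * N t * N (t * s) * E t) * I t * indicator {1..} s \<partial>lborel)"
        using AE_lborel_singleton[of 1]
        by (intro nn_integral_cong_AE, eventually_elim)
           (use True in \<open>auto simp: K_def I_def ennreal_mult'[symmetric] mult.assoc zero_less_mult_iff split: split_indicator\<close>)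
      finally show ?thesis .
    qed (simp add: K_def I_def)
  qed
  also have "\<dots> = (\<integral>\<^sup>+s. \<integral>\<^sup>+t. ennreal (t * N t * N (t * s) * E t) * I t * indicator {1..} s \<partial>lborel \<partial>lborel)"
    by (rule lborel_pair.Fubini') measurable
  also have "\<dots> = (\<integral>\<^sup>+s. ennreal (1 / (2 * pi)) * (ennreal (1 / (\<beta>\<^sup>2 + s\<^sup>2)) * indicator {1..} s) \<partial>lborel)"
  proof (rule nn_integral_cong)
    fix s :: real
    have p: "0 < \<beta>\<^sup>2 + s\<^sup>2" using \<beta>(1) by (simp add: add_pos_nonneg)
    then have *: "(\<integral>\<^sup>+t. ennreal (t * exp (- ((\<beta>\<^sup>2 + s\<^sup>2) / (2 * \<sigma>\<^sup>2)) * t\<^sup>2)) * I t \<partial>lborel) = ennreal (1 / (2 * ((\<beta>\<^sup>2 + s\<^sup>2) / (2 * \<sigma>\<^sup>2))))"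
      unfolding I_def using assms by (intro half_line_linear_gaussian) simp
    have **: "(\<integral>\<^sup>+t. c * ennreal (t * exp (- ((\<beta>\<^sup>2 + s\<^sup>2) / (2 * \<sigma>\<^sup>2)) * t\<^sup>2)) * I t * d \<partial>lborel)
      = c * (\<integral>\<^sup>+t. ennreal (t * exp (- ((\<beta>\<^sup>2 + s\<^sup>2) / (2 * \<sigma>\<^sup>2)) * t\<^sup>2)) * I t \<partial>lborel) * d" for c d
      unfolding mult.assoc[of c] by (subst nn_integral_cmult, measurable, subst nn_integral_multc, measurable)
    have "(\<integral>\<^sup>+t. ennreal (t * N t * N (t * s) * E t) * I t * indicator {1..} s \<partial>lborel)
      = ennreal (1 / (2 * pi * \<sigma>\<^sup>2)) * ennreal (1 / (2 * ((\<beta>\<^sup>2 + s\<^sup>2) / (2 * \<sigma>\<^sup>2)))) * indicator {1..} s"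
      unfolding NE by (subst ennreal_mult', simp) (simp only: ** *)
    also have "\<dots> = ennreal (1 / (2 * pi)) * (ennreal (1 / (\<beta>\<^sup>2 + s\<^sup>2)) * indicator {1..} s)"
    proof -
      have "ennreal (1 / (2 * pi * \<sigma>\<^sup>2)) * ennreal (1 / (2 * ((\<beta>\<^sup>2 + s\<^sup>2) / (2 * \<sigma>\<^sup>2))))
        = ennreal (1 / (2 * pi * \<sigma>\<^sup>2) * (1 / (2 * ((\<beta>\<^sup>2 + s\<^sup>2) / (2 * \<sigma>\<^sup>2)))))"
        by (rule ennreal_mult'[symmetric]) simp
      also have "1 / (2 * pi * \<sigma>\<^sup>2) * (1 / (2 * ((\<beta>\<^sup>2 + s\<^sup>2) / (2 * \<sigma>\<^sup>2)))) = 1 / (2 * pi) * (1 / (\<beta>\<^sup>2 + s\<^sup>2))"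
        using p assms(1) by (simp add: field_simps)
      finally show ?thesis
        using ennreal_mult'[of "1 / (2 * pi)" "1 / (\<beta>\<^sup>2 + s\<^sup>2)"] by (simp only: mult.assoc[symmetric]) simp
    qed
    finally show "(\<integral>\<^sup>+t. ennreal (t * N t * N (t * s) * E t) * I t * indicator {1..} s \<partial>lborel) = \<dots>" .
  qed
  also have "\<dots> = ennreal (1 / (2 * pi) * ((pi / 2 - arctan (1 / \<beta>)) / \<beta>))"
    by (simp add: nn_integral_cmult nn_integral_inverse_sum_squares[OF \<beta>(1)] ennreal_mult'[symmetric])
  finally have L: "L = ennreal (1 / (2 * pi) * ((pi / 2 - arctan (1 / \<beta>)) / \<beta>))" (is "_ = ennreal ?l") .
  have l0: "0 \<le> ?l"
    using \<beta>(1) arctan_ubound[of "1/\<beta>"] by (intro mult_nonneg_nonneg divide_nonneg_pos) auto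
  have A_l: "A + ennreal (?l + ?l) = ennreal (1/4)"
    using sum unfolding KL L using l0 by (simp add: ennreal_plus[symmetric] del: ennreal_plus)
  have eq: "1/4 - (1 / (2 * pi) * ((pi / 2 - a) / \<beta>) + 1 / (2 * pi) * ((pi / 2 - a) / \<beta>))
      = (2 / pi * (1 / \<beta>) * a - 1 / \<beta> + 1 / 2) / 2" for a
    using \<beta>(1) by (simp add: field_simps)
  from A_l have "A = ennreal (1/4 - (?l + ?l))"
    by (rule ennreal_eq_diffI) (rule add_nonneg_nonneg[OF l0 l0])
  then show "(\<integral>\<^sup>+x. ennreal (exponential_density 1 x) * ennreal ((gauss_tail \<sigma> (\<kappa> * sqrt x))\<^sup>2) \<partial>lborel)
    = ennreal ((2 / pi * (1 / \<beta>) * arctan (1 / \<beta>) - 1 / \<beta> + 1 / 2) / 2)"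
    unfolding A_def[symmetric] eq .
  \<comment> \<open>Since \<open>ennreal\<close> sends negative reals to 0, the equation for
    \<open>A\<close> does not reveal the sign of its argument. The bound
    \<open>?l + ?l \<le> 1/4\<close> is read off the sum instead.\<close>
  have "ennreal (?l + ?l) \<le> A + ennreal (?l + ?l)"
    by simp
  also note A_l
  finally have "?l + ?l \<le> 1/4"
    by (subst (asm) ennreal_le_iff) simp_all
  then show "0 \<le> (2 / pi * (1 / \<beta>) * arctan (1 / \<beta>) - 1 / \<beta> + 1 / 2) / 2"
    unfolding eq[symmetric] by simp
qed

subsection \<open>Lebesgue measure on the complex plane and circular Gaussian densities\<close>

lemma measurable_Complex [measurable (raw)]:
  assumes [measurable]: "f \<in> borel_measurable M" "g \<in> borel_measurable M"
  shows "(\<lambda>x. Complex (f x) (g x)) \<in> borel_measurable M"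
  unfolding Complex_eq by measurable

text \<open>Lebesgue measure is characterised by the volumes of boxes, and a complex box pulls back
  to a product of two intervals.\<close>

lemma lborel_eq_distr_Complex:
  "lborel = distr (lborel \<Otimes>\<^sub>M lborel) borel (\<lambda>p. Complex (fst p) (snd p))"
proof (rule lborel_eqI)
  fix l u :: complex
  assume le: "\<And>b. b \<in> Basis \<Longrightarrow> l \<bullet> b \<le> u \<bullet> b"
  have le: "Re l \<le> Re u" "Im l \<le> Im u"
    using le[of 1] le[of \<i>] by (auto simp: Basis_complex_def)
  have "(\<lambda>p. Complex (fst p) (snd p)) -` box l u \<inter> space (lborel \<Otimes>\<^sub>M lborel)
      = {Re l<..<Re u} \<times> {Im l<..<Im u}"
    by (auto simp: in_box_complex_iff space_pair_measure)
  then show "emeasure (distr (lborel \<Otimes>\<^sub>M lborel) borel (\<lambda>p. Complex (fst p) (snd p))) (box l u)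
      = (\<Prod>b\<in>Basis. (u - l) \<bullet> b)"
    using le by (simp add: emeasure_distr lborel.emeasure_pair_measure_Times Basis_complex_def
        ennreal_mult'[symmetric])
qed simp

lemma nn_integral_lborel_complex:
  assumes [measurable]: "f \<in> borel_measurable borel"
  shows "(\<integral>\<^sup>+z. f z \<partial>lborel) = (\<integral>\<^sup>+x. \<integral>\<^sup>+y. f (Complex x y) \<partial>lborel \<partial>lborel)"
  by (subst lborel_eq_distr_Complex) (simp add: nn_integral_distr lborel.nn_integral_fst[symmetric])

text \<open>The two one-dimensional substitutions contribute the factors |a| and 1/|a|, which
  cancel. Dividing by \<open>a\<close> is the reason for excluding a purely imaginary
  \<open>u\<close>.\<close>

lemma nn_integral_lborel_rotate_aux:
  assumes [measurable]: "f \<in> borel_measurable borel" and u: "cmod u = 1" "Re u \<noteq> 0"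
  shows "(\<integral>\<^sup>+z. f (u * z) \<partial>lborel) = (\<integral>\<^sup>+z. f z \<partial>lborel)"
proof -
  define a b where "a = Re u" and "b = Im u"
  have a: "a \<noteq> 0" using u by (simp add: a_def)
  have u_eq: "u = Complex a b" by (simp add: a_def b_def)
  have ab: "a * a + b * b = 1"
    using u(1) by (simp add: cmod_def a_def b_def power2_eq_square)
  \<comment> \<open>The rotation factors into one-dimensional affine maps, first in \<open>x\<close>, then in \<open>y\<close>.\<close>
  let ?g = "\<lambda>x y. f (Complex x ((b * x + y) / a))"
  \<comment> \<open>The new imaginary part b x + a y is rewritten through the new real part x' = a x
    - b y and the old y as (b x' + y) / a, by a^2 + b^2 = 1.\<close>
  have eq: "f (u * Complex x y) = ?g (- (b * y) + a * x) y" for x y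
  proof -
    have "b * (- (b * y) + a * x) + y = a * (b * x) + (1 - b * b) * y"
      by (simp add: algebra_simps)
    also have "1 - b * b = a * a" using ab by simp
    finally have "(b * (- (b * y) + a * x) + y) / a = b * x + a * y"
      using a by (simp add: add_divide_distrib)
    then show ?thesis by (simp add: u_eq complex_mult algebra_simps)
  qed
  have "(\<integral>\<^sup>+z. f (u * z) \<partial>lborel) = (\<integral>\<^sup>+x. \<integral>\<^sup>+y. ?g (- (b * y) + a * x) y \<partial>lborel \<partial>lborel)"
    by (subst nn_integral_lborel_complex) (simp_all add: eq)
  also have "\<dots> = (\<integral>\<^sup>+y. \<integral>\<^sup>+x. ?g (- (b * y) + a * x) y \<partial>lborel \<partial>lborel)"
    by (rule lborel_pair.Fubini') measurable
  also have "\<dots> = (\<integral>\<^sup>+y. ennreal (1 / \<bar>a\<bar>) * (\<integral>\<^sup>+x. ?g x y \<partial>lborel) \<partial>lborel)"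
  proof (rule nn_integral_cong)
    fix y
    have "(\<integral>\<^sup>+x. ?g x y \<partial>lborel) = ennreal \<bar>a\<bar> * (\<integral>\<^sup>+x. ?g (- (b * y) + a * x) y \<partial>lborel)"
      using a by (intro nn_integral_real_affine) auto
    then show "(\<integral>\<^sup>+x. ?g (- (b * y) + a * x) y \<partial>lborel) = ennreal (1 / \<bar>a\<bar>) * (\<integral>\<^sup>+x. ?g x y \<partial>lborel)"
      using a by (simp add: mult.assoc[symmetric] ennreal_mult'[symmetric])
  qed
  also have "\<dots> = ennreal (1 / \<bar>a\<bar>) * (\<integral>\<^sup>+y. \<integral>\<^sup>+x. ?g x y \<partial>lborel \<partial>lborel)"
    by (rule nn_integral_cmult) measurable
  also have "(\<integral>\<^sup>+y. \<integral>\<^sup>+x. ?g x y \<partial>lborel \<partial>lborel) = (\<integral>\<^sup>+x. \<integral>\<^sup>+y. ?g x y \<partial>lborel \<partial>lborel)"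
    by (rule lborel_pair.Fubini') measurable
  also have "\<dots> = (\<integral>\<^sup>+x. ennreal \<bar>a\<bar> * (\<integral>\<^sup>+y. f (Complex x y) \<partial>lborel) \<partial>lborel)"
  proof (rule nn_integral_cong)
    fix x
    have "(b * x + (- (b * x) + a * y)) / a = y" for y
      using a by simp
    then show "(\<integral>\<^sup>+y. ?g x y \<partial>lborel) = ennreal \<bar>a\<bar> * (\<integral>\<^sup>+y. f (Complex x y) \<partial>lborel)"
      using a by (subst nn_integral_real_affine[where c=a and t="- (b * x)"]) simp_all
  qed
  also have "\<dots> = ennreal \<bar>a\<bar> * (\<integral>\<^sup>+z. f z \<partial>lborel)"
    by (subst nn_integral_cmult) (simp_all add: nn_integral_lborel_complex)
  finally show ?thesis
    using a by (simp add: mult.assoc[symmetric] ennreal_mult'[symmetric])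
qed

lemma nn_integral_lborel_rotate:
  assumes [measurable]: "f \<in> borel_measurable borel" and u: "cmod u = 1"
  shows "(\<integral>\<^sup>+z. f (u * z) \<partial>lborel) = (\<integral>\<^sup>+z. f z \<partial>lborel)"
proof (cases "Re u = 0")
  case False
  then show ?thesis by (intro nn_integral_lborel_rotate_aux assms)
next
  case True
  \<comment> \<open>A purely imaginary \<open>u\<close> is a product of two unit numbers with nonzero real part.\<close>
  define v where "v = Complex (3/5) (4/5)"
  have v: "cmod v = 1" "Re v \<noteq> 0"
    by (auto simp: v_def cmod_def power2_eq_square)
  have "Im u \<noteq> 0" using True u by (auto simp: cmod_def)
  \<comment> \<open>For imaginary \<open>u\<close> this real part is \<open>Im u * Im v\<close>;
    hence \<open>v\<close> has both coordinates nonzero, and the triple 3, 4, 5 makes them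
    rational.\<close>
  then have w: "cmod (u * cnj v) = 1" "Re (u * cnj v) \<noteq> 0"
    using True u v by (simp add: norm_mult, simp add: v_def)
  have "v * cnj v = 1"
    using v by (simp add: complex_norm_square[symmetric])
  then have eq: "u * z = v * ((u * cnj v) * z)" for z
    by (simp add: mult.left_commute[of v] mult.assoc)
      (simp add: mult.assoc[symmetric] mult.commute[of "cnj v"])
  have "(\<integral>\<^sup>+z. f (u * z) \<partial>lborel) = (\<integral>\<^sup>+z. f (v * ((u * cnj v) * z)) \<partial>lborel)"
    by (simp only: eq[symmetric])
  also have "\<dots> = (\<integral>\<^sup>+z. f (v * z) \<partial>lborel)"
    by (rule nn_integral_lborel_rotate_aux[where f="\<lambda>z. f (v * z)"]) (use w in auto)
  also have "\<dots> = (\<integral>\<^sup>+z. f z \<partial>lborel)"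
    by (rule nn_integral_lborel_rotate_aux) (use v in auto)
  finally show ?thesis .
qed

lemma nn_integral_lborel_shift:
  fixes c :: "'a::euclidean_space"
  assumes [measurable]: "f \<in> borel_measurable borel"
  shows "(\<integral>\<^sup>+z. f (c + z) \<partial>lborel) = (\<integral>\<^sup>+z. f z \<partial>lborel)"
  by (subst (2) lborel_distr_plus[of c, symmetric]) (simp add: nn_integral_distr)

lemma cgauss_density_nonneg: "0 < v \<Longrightarrow> 0 \<le> cgauss_density v z"
  by (simp add: cgauss_density_def)

lemma borel_measurable_cgauss_density [measurable]: "cgauss_density v \<in> borel_measurable borel"
  unfolding cgauss_density_def[abs_def] by measurable

lemma cgauss_density_Complex:
  assumes "0 < v"
  shows "cgauss_density v (Complex x y) = normal_density 0 (sqrt v) x * normal_density 0 (sqrt v) y"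
proof -
  have "exp (- (x\<^sup>2 + y\<^sup>2) / (2 * v)) = exp (- x\<^sup>2 / (2 * v)) * exp (- y\<^sup>2 / (2 * v))"
    by (simp add: exp_add[symmetric] diff_divide_distrib add_divide_distrib)
  then show ?thesis
    using assms by (simp add: cgauss_density_def normal_density_def cmod_def)
qed

text \<open>Both densities factor over real and imaginary part, so the variances add by the
  one-dimensional rule in each coordinate.\<close>

lemma cgauss_density_convolution:
  assumes "0 < a" "0 < b"
  shows "(\<integral>\<^sup>+w. ennreal (cgauss_density a (z - w)) * ennreal (cgauss_density b w) \<partial>lborel)
    = ennreal (cgauss_density (a + b) z)"
proof -
  let ?n = "\<lambda>v x. ennreal (normal_density 0 (sqrt v) x)"
  have conv: "(\<integral>\<^sup>+y. ?n a (x - y) * ?n b y \<partial>lborel) = ?n (a + b) x" for x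
    using conv_normal_density_zero_mean[of "sqrt a" "sqrt b"] assms
    by (simp add: fun_eq_iff ennreal_mult)
  have eq: "ennreal (cgauss_density a (z - Complex x y)) * ennreal (cgauss_density b (Complex x y))
     = (?n a (Re z - x) * ?n b x) * (?n a (Im z - y) * ?n b y)" for x y
  proof -
    have "z - Complex x y = Complex (Re z - x) (Im z - y)"
      by (simp add: complex_eq_iff)
    then show ?thesis
      using assms by (simp add: cgauss_density_Complex ennreal_mult ac_simps)
  qed
  have "(\<integral>\<^sup>+w. ennreal (cgauss_density a (z - w)) * ennreal (cgauss_density b w) \<partial>lborel)
    = (\<integral>\<^sup>+x. \<integral>\<^sup>+y. (?n a (Re z - x) * ?n b x) * (?n a (Im z - y) * ?n b y) \<partial>lborel \<partial>lborel)"
    by (subst nn_integral_lborel_complex) (simp_all add: eq)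
  also have "\<dots> = ?n (a + b) (Re z) * ?n (a + b) (Im z)"
    by (simp add: nn_integral_cmult nn_integral_multc conv)
  also have "\<dots> = ennreal (cgauss_density (a + b) z)"
    using cgauss_density_Complex[of "a + b" "Re z" "Im z"] assms by (simp add: ennreal_mult)
  finally show ?thesis .
qed

subsection \<open>QAM decision cells\<close>

lemma abs_le_abs_add_iff:
  fixes x t :: real
  shows "\<bar>x\<bar> \<le> \<bar>x + t\<bar> \<longleftrightarrow> 0 \<le> t * (2 * x + t)"
proof -
  have "\<bar>x\<bar> \<le> \<bar>x + t\<bar> \<longleftrightarrow> x\<^sup>2 \<le> (x + t)\<^sup>2"
    by (rule abs_le_square_iff)
  also have "\<dots> \<longleftrightarrow> 0 \<le> t * (2 * x + t)"
    by (simp add: power2_eq_square algebra_simps)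
  finally show ?thesis .
qed

text \<open>\<open>x\<close> is the deviation from level \<open>n\<close> and \<open>e\<close> the
  spacing after fading. Adjacent levels give the tightest constraints; an end level lacks a
  neighbour, whence the guards.\<close>

lemma pam_cell_iff:
  assumes "0 < e" "n < m"
  shows "(\<forall>k<m. \<bar>x\<bar> \<le> \<bar>x + (real n - real k) * e\<bar>)
    \<longleftrightarrow> (0 < n \<longrightarrow> - (e / 2) \<le> x) \<and> (Suc n < m \<longrightarrow> x \<le> e / 2)"
proof (intro iffI conjI impI allI)
  assume *: "\<forall>k<m. \<bar>x\<bar> \<le> \<bar>x + (real n - real k) * e\<bar>"
  show "- (e / 2) \<le> x" if "0 < n"
    using *[rule_format, of "n - 1"] that assms
    by (simp add: abs_le_abs_add_iff of_nat_diff zero_le_mult_iff less_imp_diff_less)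
  show "x \<le> e / 2" if "Suc n < m"
    using *[rule_format, of "Suc n"] that assms
    by (simp add: abs_le_abs_add_iff zero_le_mult_iff mult_le_0_iff)
next
  fix k assume *: "(0 < n \<longrightarrow> - (e / 2) \<le> x) \<and> (Suc n < m \<longrightarrow> x \<le> e / 2)" and "k < m"
  consider "k < n" | "k = n" | "n < k" by linarith
  then show "\<bar>x\<bar> \<le> \<bar>x + (real n - real k) * e\<bar>"
  proof cases
    case 1
    then have "1 * e \<le> (real n - real k) * e"
      using assms by (intro mult_right_mono) auto
    moreover have "- (e / 2) \<le> x" using * 1 by auto
    ultimately have "0 \<le> 2 * x + (real n - real k) * e" by linarith
    then show ?thesis
      unfolding abs_le_abs_add_iff using 1 assms by (intro mult_nonneg_nonneg) auto
  next
    case 3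
    then have "1 * e \<le> (real k - real n) * e"
      using assms by (intro mult_right_mono) auto
    moreover have "x \<le> e / 2" using * 3 \<open>k < m\<close> by auto
    moreover have "(real n - real k) * e = - ((real k - real n) * e)" by (simp add: algebra_simps)
    ultimately have "2 * x + (real n - real k) * e \<le> 0" by linarith
    then show ?thesis
      unfolding abs_le_abs_add_iff using 3 assms
      by (intro mult_nonpos_nonpos mult_nonpos_nonneg) auto
  qed simp
qed

lemma normal_density_total:
  assumes "0 < \<sigma>"
  shows "(\<integral>\<^sup>+x. ennreal (normal_density 0 \<sigma> x) \<partial>lborel) = 1"
  using prob_space.emeasure_space_1[OF prob_space_normal_density[OF assms, of 0]]
  by (simp add: emeasure_density)

lemma gauss_tail_lower:
  assumes "0 < \<sigma>"
  shows "(\<integral>\<^sup>+x. ennreal (normal_density 0 \<sigma> x) * indicator {..< - c} x \<partial>lborel) = ennreal (gauss_tail \<sigma> c)"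
proof -
  have "(\<integral>\<^sup>+x. ennreal (normal_density 0 \<sigma> x) * indicator {..< - c} x \<partial>lborel)
    = (\<integral>\<^sup>+x. ennreal (normal_density 0 \<sigma> x) * indicator {c<..} x \<partial>lborel)"
    by (subst nn_integral_real_affine[where c="-1" and t=0])
       (auto simp: normal_density_def split: split_indicator intro!: nn_integral_cong)
  then show ?thesis by (simp add: emeasure_gauss_tail[OF assms])
qed

text \<open>The probability that one Gaussian coordinate stays in the cell of level \<open>n\<close>
  out of \<open>m\<close>, with \<open>c\<close> half the spacing: an inner level loses two tails,
  an end level one, and the single level for \<open>m = 1\<close> none.\<close>

definition pam_correct :: "real \<Rightarrow> nat \<Rightarrow> real \<Rightarrow> nat \<Rightarrow> real" where
  "pam_correct \<sigma> m c n =
    1 - (if 0 < n then gauss_tail \<sigma> c else 0) - (if Suc n < m then gauss_tail \<sigma> c else 0)"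

lemma nn_integral_pam_cell:
  assumes "0 < \<sigma>" "0 < c"
  shows "(\<integral>\<^sup>+x. ennreal (normal_density 0 \<sigma> x) *
      indicator {x. (0 < n \<longrightarrow> - c \<le> x) \<and> (Suc n < m \<longrightarrow> x \<le> c)} x \<partial>lborel)
    = ennreal (pam_correct \<sigma> m c n)" (is "?I = _")
proof -
  define l where "l = (if 0 < n then gauss_tail \<sigma> c else 0)"
  define u where "u = (if Suc n < m then gauss_tail \<sigma> c else 0)"
  have lu: "0 \<le> l" "0 \<le> u"
    using gauss_tail_bounds[OF assms(1)] by (auto simp: l_def u_def)
  have "?I + ennreal (l + u) = ?I
     + ((\<integral>\<^sup>+x. ennreal (normal_density 0 \<sigma> x) * (if 0 < n then indicator {..< - c} x else 0) \<partial>lborel)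
     + (\<integral>\<^sup>+x. ennreal (normal_density 0 \<sigma> x) * (if Suc n < m then indicator {c<..} x else 0) \<partial>lborel))"
    using lu by (auto simp: l_def u_def gauss_tail_lower emeasure_gauss_tail assms)
  also have "\<dots> = (\<integral>\<^sup>+x. ennreal (normal_density 0 \<sigma> x) *
      indicator {x. (0 < n \<longrightarrow> - c \<le> x) \<and> (Suc n < m \<longrightarrow> x \<le> c)} x
     + (ennreal (normal_density 0 \<sigma> x) * (if 0 < n then indicator {..< - c} x else 0)
     + ennreal (normal_density 0 \<sigma> x) * (if Suc n < m then indicator {c<..} x else 0)) \<partial>lborel)"
    by (simp add: nn_integral_add)
  \<comment> \<open>The cell and the removed tails partition the line; \<open>0 < c\<close> keeps
    the two tails disjoint.\<close>
  also have "\<dots> = (\<integral>\<^sup>+x. ennreal (normal_density 0 \<sigma> x) \<partial>lborel)"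
    using assms(2) by (intro nn_integral_cong) (auto split: split_indicator)
  also have "\<dots> = ennreal 1" using normal_density_total[OF assms(1)] by simp
  finally have "?I = ennreal (1 - (l + u))"
    by (rule ennreal_eq_diffI) (use lu in simp)
  then show ?thesis by (simp add: pam_correct_def l_def u_def diff_diff_eq)
qed

text \<open>An inner level loses two tails, so this bound keeps \<open>pam_correct\<close>
  nonnegative.\<close>

lemma gauss_tail_le_half:
  assumes "0 < \<sigma>" "0 \<le> c" shows "gauss_tail \<sigma> c \<le> 1 / 2"
proof -
  have "ennreal (gauss_tail \<sigma> c) \<le> ennreal (1 / 2)"
    unfolding emeasure_gauss_tail[OF assms(1), symmetric] half_gaussian_0[OF assms(1), symmetric]
    using assms(2) by (intro nn_integral_mono) (auto split: split_indicator)
  then show ?thesis by (subst (asm) ennreal_le_iff) simp_all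
qed

lemma pam_correct_nonneg:
  assumes "0 < \<sigma>" "0 \<le> c" shows "0 \<le> pam_correct \<sigma> m c n"
  using gauss_tail_le_half[OF assms] by (auto simp: pam_correct_def)

text \<open>Exactly m - 1 levels have a lower neighbour, and m - 1 an upper one.\<close>

lemma sum_pam_correct:
  assumes "1 \<le> m"
  shows "(\<Sum>n<m. pam_correct \<sigma> m c n) = real m - 2 * (real m - 1) * gauss_tail \<sigma> c"
proof -
  obtain k where m: "m = Suc k" using assms by (cases m) auto
  have 1: "(\<Sum>n<m. if 0 < n then gauss_tail \<sigma> c else 0) = real k * gauss_tail \<sigma> c"
    unfolding m by (subst sum.lessThan_Suc_shift) simp
  have 2: "(\<Sum>n<m. if Suc n < m then gauss_tail \<sigma> c else 0) = real k * gauss_tail \<sigma> c"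
    unfolding m by simp
  show ?thesis
    unfolding pam_correct_def sum_subtractf 1 2 by (simp add: m)
qed

text \<open>Squared moduli add over coordinates. The zero shifts, contributed by the true symbol
  itself, allow one coordinate to be tested while the other is kept fixed.\<close>

lemma cmod_Complex_le_iff:
  assumes "i < (I::nat)" "j < J" "a i = 0" "b j = 0"
  shows "(\<forall>k<I. \<forall>l<J. cmod (Complex x y) \<le> cmod (Complex x y + Complex (a k) (b l)))
    \<longleftrightarrow> (\<forall>k<I. \<bar>x\<bar> \<le> \<bar>x + a k\<bar>) \<and> (\<forall>l<J. \<bar>y\<bar> \<le> \<bar>y + b l\<bar>)"
proof -
  have eq: "cmod (Complex x y) \<le> cmod (Complex x y + Complex (a k) (b l))
    \<longleftrightarrow> x\<^sup>2 + y\<^sup>2 \<le> (x + a k)\<^sup>2 + (y + b l)\<^sup>2" for k l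
    by (simp add: cmod_def)
  show ?thesis
    unfolding eq abs_le_square_iff
  proof (intro iffI conjI allI impI)
    assume *: "\<forall>k<I. \<forall>l<J. x\<^sup>2 + y\<^sup>2 \<le> (x + a k)\<^sup>2 + (y + b l)\<^sup>2"
    show "x\<^sup>2 \<le> (x + a k)\<^sup>2" if "k < I" for k using * that assms by force
    show "y\<^sup>2 \<le> (y + b l)\<^sup>2" if "l < J" for l using * that assms by force
  next
    fix k l assume "(\<forall>k<I. x\<^sup>2 \<le> (x + a k)\<^sup>2) \<and> (\<forall>l<J. y\<^sup>2 \<le> (y + b l)\<^sup>2)" "k < I" "l < J"
    then show "x\<^sup>2 + y\<^sup>2 \<le> (x + a k)\<^sup>2 + (y + b l)\<^sup>2" by (intro add_mono) auto
  qed
qed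

definition qam_point :: "nat \<Rightarrow> nat \<Rightarrow> real \<Rightarrow> nat \<Rightarrow> nat \<Rightarrow> complex" where
  "qam_point MI MQ P0 n q =
    Complex (pam_level MI (qam_dmin MI MQ P0) n) (pam_level MQ (qam_dmin MI MQ P0) q)"

lemma qam_constellation_eq:
  "qam_constellation MI MQ P0 = (\<lambda>(n, q). qam_point MI MQ P0 n q) ` ({..<MI} \<times> {..<MQ})"
  by (auto simp: qam_constellation_def qam_point_def)

lemma qam_point_diff:
  "qam_point MI MQ P0 n q - qam_point MI MQ P0 k l =
    Complex ((real n - real k) * qam_dmin MI MQ P0) ((real q - real l) * qam_dmin MI MQ P0)"
  by (simp add: qam_point_def pam_level_def complex_eq_iff field_simps)

text \<open>M_I^2 + M_Q^2 is at least 2 M_I M_Q, hence at least 4; excluding the 1 x 1 grid keeps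
  the denominator in \<open>qam_dmin\<close> away from zero.\<close>

lemma qam_dmin_pos:
  assumes "1 \<le> MI" "1 \<le> MQ" "2 \<le> MI * MQ" "0 < P0"
  shows "0 < (real MI)\<^sup>2 + (real MQ)\<^sup>2 - 2" "0 < qam_dmin MI MQ P0"
proof -
  have "(real MI)\<^sup>2 + (real MQ)\<^sup>2 - 2 * (real MI * real MQ) = (real MI - real MQ)\<^sup>2"
    by (simp add: power2_eq_square algebra_simps)
  moreover have "0 \<le> (real MI - real MQ)\<^sup>2" by simp
  moreover have "2 \<le> real MI * real MQ"
    using assms(3) by (metis of_nat_le_iff of_nat_mult of_nat_numeral)
  ultimately show "0 < (real MI)\<^sup>2 + (real MQ)\<^sup>2 - 2" by linarith
  then show "0 < qam_dmin MI MQ P0"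
    using assms by (simp add: qam_dmin_def)
qed

lemma inj_on_qam_point:
  assumes "0 < qam_dmin MI MQ P0"
  shows "inj_on (\<lambda>(n, q). qam_point MI MQ P0 n q) A"
proof (rule inj_onI, clarify)
  fix n q k l assume "qam_point MI MQ P0 n q = qam_point MI MQ P0 k l"
  then show "n = k \<and> q = l"
    using qam_point_diff[of MI MQ P0 n q k l] assms by (simp add: complex_eq_iff)
qed

lemma sets_nearest [measurable]:
  fixes s :: complex
  shows "{z. \<forall>s'\<in>C. cmod z \<le> cmod (z + r * (s - s'))} \<in> sets borel"
proof -
  have "{z. \<forall>s'\<in>C. cmod z \<le> cmod (z + r * (s - s'))} = (\<Inter>s'\<in>C. {z. cmod z \<le> cmod (z + r * (s - s'))})"
    by auto
  also have "closed \<dots>"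
    by (intro closed_INT ballI closed_Collect_le continuous_intros)
  finally show ?thesis by simp
qed

text \<open>\<open>z\<close> is the disturbance, so the shifted argument is the deviation from the
  candidate \<open>s\<close>. For a positive real gain the cell is a product of two, possibly
  unbounded, intervals, and the circular density factors accordingly.\<close>

lemma nn_integral_cgauss_qam_cell:
  assumes "0 < v" "0 < r" "0 < qam_dmin MI MQ P0" "n < MI" "q < MQ"
  defines "c \<equiv> r * qam_dmin MI MQ P0 / 2"
  shows "(\<integral>\<^sup>+z. ennreal (cgauss_density v z) *
      indicator {z. \<forall>s\<in>qam_constellation MI MQ P0. cmod z \<le> cmod (z + of_real r * (qam_point MI MQ P0 n q - s))} z \<partial>lborel)
    = ennreal (pam_correct (sqrt v) MI c n * pam_correct (sqrt v) MQ c q)"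
proof -
  define d where "d = r * qam_dmin MI MQ P0"
  have d: "0 < d" and c: "0 < c" using assms(2,3) by (simp_all add: d_def c_def)
  have set_eq: "(\<forall>s\<in>qam_constellation MI MQ P0. cmod (Complex x y) \<le> cmod (Complex x y + of_real r * (qam_point MI MQ P0 n q - s)))
    \<longleftrightarrow> ((0 < n \<longrightarrow> - c \<le> x) \<and> (Suc n < MI \<longrightarrow> x \<le> c)) \<and> ((0 < q \<longrightarrow> - c \<le> y) \<and> (Suc q < MQ \<longrightarrow> y \<le> c))" for x y
  proof -
    have "of_real r * (qam_point MI MQ P0 n q - qam_point MI MQ P0 k l)
      = Complex ((real n - real k) * d) ((real q - real l) * d)" for k l
      by (simp add: qam_point_diff complex_eq_iff d_def)
    then have "(\<forall>s\<in>qam_constellation MI MQ P0. cmod (Complex x y) \<le> cmod (Complex x y + of_real r * (qam_point MI MQ P0 n q - s)))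
      \<longleftrightarrow> (\<forall>k<MI. \<forall>l<MQ. cmod (Complex x y) \<le> cmod (Complex x y + Complex ((real n - real k) * d) ((real q - real l) * d)))"
      unfolding qam_constellation_eq by force
    also have "\<dots> \<longleftrightarrow> (\<forall>k<MI. \<bar>x\<bar> \<le> \<bar>x + (real n - real k) * d\<bar>) \<and> (\<forall>l<MQ. \<bar>y\<bar> \<le> \<bar>y + (real q - real l) * d\<bar>)"
      by (rule cmod_Complex_le_iff[of n MI q MQ]) (use assms in auto)
    finally show ?thesis
      using pam_cell_iff[OF d] assms by (simp add: c_def d_def)
  qed
  let ?I = "\<lambda>n m. indicator {x. (0 < n \<longrightarrow> - c \<le> x) \<and> (Suc n < m \<longrightarrow> x \<le> c)} :: real \<Rightarrow> ennreal"
  define A where "A = {z. \<forall>s\<in>qam_constellation MI MQ P0. cmod z \<le> cmod (z + of_real r * (qam_point MI MQ P0 n q - s))}"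
  have [measurable]: "A \<in> sets borel" unfolding A_def by (rule sets_nearest)
  have "indicator A (Complex x y) = ?I n MI x * ?I q MQ y" for x y
    by (simp add: indicator_def A_def set_eq)
  then have "(\<integral>\<^sup>+z. ennreal (cgauss_density v z) * indicator A z \<partial>lborel)
    = (\<integral>\<^sup>+x. \<integral>\<^sup>+y. (ennreal (normal_density 0 (sqrt v) x) * ?I n MI x) * (ennreal (normal_density 0 (sqrt v) y) * ?I q MQ y) \<partial>lborel \<partial>lborel)"
    by (subst nn_integral_lborel_complex)
       (simp_all add: cgauss_density_Complex assms(1) ennreal_mult ac_simps)
  also have "\<dots> = ennreal (pam_correct (sqrt v) MI c n) * ennreal (pam_correct (sqrt v) MQ c q)"
    using assms(1) c by (simp add: nn_integral_cmult nn_integral_multc nn_integral_pam_cell)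
  finally show ?thesis
    using pam_correct_nonneg[of "sqrt v" c] assms by (simp add: ennreal_mult A_def)
qed

subsection \<open>Average number of correct decisions under Rayleigh fading\<close>

text \<open>The bracket of the theorem for a single variance; the busy-state term is its average
  with weights \<open>lam\<close>.\<close>

definition qam_error :: "nat \<Rightarrow> nat \<Rightarrow> real \<Rightarrow> real" where
  "qam_error MI MQ \<beta> = (2 - 1 / real MI - 1 / real MQ) * (1 - 1 / \<beta>)
     - 2 * (1 - 1 / real MI) * (1 - 1 / real MQ) *
         (2 / pi * (1 / \<beta>) * arctan (1 / \<beta>) - 1 / \<beta> + 1 / 2)"

lemma borel_measurable_pam_correct:
  assumes [measurable]: "f \<in> borel_measurable M" and "0 < \<sigma>"
  shows "(\<lambda>x. pam_correct \<sigma> m (f x) n) \<in> borel_measurable M"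
  unfolding pam_correct_def using measurable_compose[OF assms(1) borel_measurable_gauss_tail[OF assms(2)]]
  by measurable

text \<open>Matches the \<beta> of the Rayleigh integrals for \<sigma>^2 = v and \<kappa> = d/2: 2 v
  / (d/2)^2 = 8 v / d^2, and d^2 = 12 P0 / (M_I^2 + M_Q^2 - 2) turns 8/12 into 2/3.\<close>

lemma qam_beta_eq:
  assumes "0 < v" "0 < P0" "0 < (real MI)\<^sup>2 + (real MQ)\<^sup>2 - 2"
  shows "qam_beta MI MQ P0 v = sqrt (1 + 2 * (sqrt v)\<^sup>2 / (qam_dmin MI MQ P0 / 2)\<^sup>2)"
  using assms by (simp add: qam_beta_def qam_dmin_def power_divide field_simps)

text \<open>Summed over all symbols, the products over coordinates become a product of two sums, a
  quadratic polynomial in the tail whose moments under fading are known. The second claim lets later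
  steps leave \<open>ennreal\<close>.\<close>

lemma rayleigh_qam_correct:
  assumes "1 \<le> MI" "1 \<le> MQ" "2 \<le> MI * MQ" "0 < P0" "0 < v"
  defines "c \<equiv> \<lambda>x. sqrt x * qam_dmin MI MQ P0 / 2"
  shows "(\<Sum>n<MI. \<Sum>q<MQ. \<integral>\<^sup>+x. ennreal (exponential_density 1 x) *
      ennreal (pam_correct (sqrt v) MI (c x) n * pam_correct (sqrt v) MQ (c x) q) \<partial>lborel)
    = ennreal (real MI * real MQ * (1 - qam_error MI MQ (qam_beta MI MQ P0 v)))" (is "?S = _")
    and "0 \<le> 1 - qam_error MI MQ (qam_beta MI MQ P0 v)"
proof -
  define \<sigma> where "\<sigma> = sqrt v"
  define \<kappa> where "\<kappa> = qam_dmin MI MQ P0 / 2"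
  define \<beta> where "\<beta> = qam_beta MI MQ P0 v"
  note dpos = qam_dmin_pos[OF assms(1-4)]
  have pos: "0 < \<sigma>" "0 < \<kappa>" using assms dpos by (auto simp: \<sigma>_def \<kappa>_def)
  have \<beta>: "\<beta> = sqrt (1 + 2 * \<sigma>\<^sup>2 / \<kappa>\<^sup>2)"
    using qam_beta_eq[OF assms(5,4) dpos(1)] by (simp add: \<beta>_def \<sigma>_def \<kappa>_def)
  define e where "e = exponential_density 1"
  define Q where "Q x = gauss_tail \<sigma> (\<kappa> * sqrt x)" for x
  have [measurable]: "e \<in> borel_measurable borel" by (simp add: e_def)
  have [measurable]: "Q \<in> borel_measurable borel"
    unfolding Q_def[abs_def] using borel_measurable_gauss_tail[OF pos(1)] by measurable
  have e0: "0 \<le> e x" for x by (simp add: e_def exponential_density_nonneg)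
  have Q01: "0 \<le> Q x" "Q x \<le> 1" for x using gauss_tail_bounds[OF pos(1)] by (auto simp: Q_def)
  have \<beta>1: "1 \<le> \<beta>" by (simp add: \<beta>)
  let ?q1 = "(1 - 1 / \<beta>) / 2"
  let ?q2 = "(2 / pi * (1 / \<beta>) * arctan (1 / \<beta>) - 1 / \<beta> + 1 / 2) / 2"
  have i0: "has_bochner_integral lborel e 1"
  proof (rule has_bochner_integral_nn_integral)
    show "(\<integral>\<^sup>+x. ennreal (e x) \<partial>lborel) = ennreal 1"
      using prob_space.emeasure_space_1[OF prob_space_exponential_density[of 1]]
      by (simp add: emeasure_density e_def)
  qed (simp_all add: e0)
  have i1: "has_bochner_integral lborel (\<lambda>x. e x * Q x) ?q1"
  proof (rule has_bochner_integral_nn_integral)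
    show "(\<integral>\<^sup>+x. ennreal (e x * Q x) \<partial>lborel) = ennreal ?q1"
      using rayleigh_gauss_tail[OF pos] e0 Q01 by (simp add: \<beta> e_def Q_def ennreal_mult)
  qed (use \<beta>1 e0 Q01 in simp_all)
  have q2: "0 \<le> ?q2"
    using rayleigh_gauss_tail_square(2)[OF pos] unfolding \<beta> .
  have i2: "has_bochner_integral lborel (\<lambda>x. e x * (Q x)\<^sup>2) ?q2"
  proof (rule has_bochner_integral_nn_integral)
    show "(\<integral>\<^sup>+x. ennreal (e x * (Q x)\<^sup>2) \<partial>lborel) = ennreal ?q2"
      using rayleigh_gauss_tail_square(1)[OF pos] e0 Q01 by (simp add: \<beta> e_def Q_def ennreal_mult)
  qed (use q2 e0 Q01 in simp_all)
  let ?F = "\<lambda>x. (real MI - 2 * (real MI - 1) * Q x) * (real MQ - 2 * (real MQ - 1) * Q x)"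
  let ?a = "2 * (real MI * (real MQ - 1) + real MQ * (real MI - 1))"
  let ?b = "4 * (real MI - 1) * (real MQ - 1)"
  have "has_bochner_integral lborel (\<lambda>x. e x * (real MI * real MQ) - e x * Q x * ?a + e x * (Q x)\<^sup>2 * ?b)
    (1 * (real MI * real MQ) - ?q1 * ?a + ?q2 * ?b)"
    by (intro has_bochner_integral_add has_bochner_integral_diff has_bochner_integral_mult_left i0 i1 i2)
  also have "(\<lambda>x. e x * (real MI * real MQ) - e x * Q x * ?a + e x * (Q x)\<^sup>2 * ?b) = (\<lambda>x. e x * ?F x)"
    by (simp add: fun_eq_iff power2_eq_square algebra_simps)
  also have "1 * (real MI * real MQ) - ?q1 * ?a + ?q2 * ?b = real MI * real MQ * (1 - qam_error MI MQ \<beta>)"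
  proof -
    \<comment> \<open>\<open>x\<close> stands for 1 - 1/\<beta> and \<open>y\<close> for the
      arctangent bracket, which are twice the moments \<open>?q1\<close> and
      \<open>?q2\<close>.\<close>
    have "1 * (I * J) - x / 2 * (2 * (I * (J - 1) + J * (I - 1))) + y / 2 * (4 * (I - 1) * (J - 1))
      = I * J * (1 - ((2 - 1 / I - 1 / J) * x - 2 * (1 - 1 / I) * (1 - 1 / J) * y))"
      if "I \<noteq> 0" "J \<noteq> 0" for I J x y :: real
      using that by (simp add: field_simps)
    then show ?thesis
      using assms(1,2) unfolding qam_error_def by simp
  qed
  finally have F: "has_bochner_integral lborel (\<lambda>x. e x * ?F x) (real MI * real MQ * (1 - qam_error MI MQ \<beta>))" .
  have pam: "0 \<le> pam_correct \<sigma> m (c x) n" if "0 \<le> x" for m n x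
    using that dpos(2) by (intro pam_correct_nonneg pos) (simp add: c_def)
  have pam_sum: "(\<Sum>n<MI. \<Sum>q<MQ. pam_correct \<sigma> MI (c x) n * pam_correct \<sigma> MQ (c x) q) = ?F x" for x
  proof -
    have "c x = \<kappa> * sqrt x" by (simp add: c_def \<kappa>_def)
    then show ?thesis
      unfolding sum_product[symmetric] Q_def by (simp only: sum_pam_correct[OF assms(1)] sum_pam_correct[OF assms(2)])
  qed
  \<comment> \<open>As a sum of products of probabilities \<open>?F\<close> is visibly nonnegative;
    for negative \<open>x\<close> the density is zero.\<close>
  have F0: "0 \<le> e x * ?F x" for x
  proof (cases "0 \<le> x")
    case True
    then show ?thesis unfolding pam_sum[symmetric] by (intro mult_nonneg_nonneg sum_nonneg e0 pam)
  qed (simp add: e_def exponential_density_def)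
  have [measurable]: "c \<in> borel_measurable borel" unfolding c_def by measurable
  have [measurable]: "(\<lambda>x. pam_correct \<sigma> m (c x) n) \<in> borel_measurable borel" for m n
    by (rule borel_measurable_pam_correct) (use pos in simp_all)
  have "?S = (\<integral>\<^sup>+x. (\<Sum>n<MI. \<Sum>q<MQ. ennreal (e x) *
      ennreal (pam_correct \<sigma> MI (c x) n * pam_correct \<sigma> MQ (c x) q)) \<partial>lborel)"
    unfolding e_def[symmetric] \<sigma>_def[symmetric] by (subst nn_integral_sum, measurable)+
  also have "\<dots> = (\<integral>\<^sup>+x. ennreal (e x * ?F x) \<partial>lborel)"
  proof (rule nn_integral_cong)
    fix x :: real
    show "(\<Sum>n<MI. \<Sum>q<MQ. ennreal (e x) * ennreal (pam_correct \<sigma> MI (c x) n * pam_correct \<sigma> MQ (c x) q)) = ennreal (e x * ?F x)"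
    proof (cases "0 \<le> x")
      case True
      show ?thesis
        unfolding pam_sum[symmetric] sum_distrib_left
        using pam[OF True] e0 by (simp add: ennreal_mult'[symmetric] sum_nonneg)
    qed (simp add: e_def exponential_density_def)
  qed
  also have "\<dots> = ennreal (real MI * real MQ * (1 - qam_error MI MQ \<beta>))"
    using F F0 by (subst nn_integral_eq_integral) (auto simp: has_bochner_integral_iff)
  finally show "?S = ennreal (real MI * real MQ * (1 - qam_error MI MQ (qam_beta MI MQ P0 v)))"
    by (simp add: \<beta>_def)
  have "0 \<le> real MI * real MQ * (1 - qam_error MI MQ \<beta>)"
    unfolding has_bochner_integral_integral_eq[OF F, symmetric] by (intro Bochner_Integration.integral_nonneg F0)
  moreover have "0 < real MI * real MQ" using assms(1,2) by simp
  ultimately show "0 \<le> 1 - qam_error MI MQ (qam_beta MI MQ P0 v)"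
    unfolding \<beta>_def[symmetric] by (metis mult_le_cancel_left_pos mult_zero_right)
qed

subsection \<open>Law of the received signal\<close>

lemma distr_Pair_indep_rv:
  assumes "prob_space N" and indep: "indep_rv N K X L Y"
  shows "distr N K X \<Otimes>\<^sub>M distr N L Y = distr N (K \<Otimes>\<^sub>M L) (\<lambda>\<omega>. (X \<omega>, Y \<omega>))"
proof -
  interpret prob_space N by fact
  have [measurable]: "X \<in> measurable N K" "Y \<in> measurable N L"
    and ind: "indep_set (sets (vimage_algebra (space N) X K)) (sets (vimage_algebra (space N) Y L))"
    using indep by (auto simp: indep_rv_def)
  interpret X: prob_space "distr N K X" by (rule prob_space_distr) fact
  interpret Y: prob_space "distr N L Y" by (rule prob_space_distr) fact
  show ?thesis
  proof (rule pair_measure_eqI)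
    fix A B assume "A \<in> sets (distr N K X)" "B \<in> sets (distr N L Y)"
    then have [measurable]: "A \<in> sets K" "B \<in> sets L" by simp_all
    have "prob ((X -` A \<inter> space N) \<inter> (Y -` B \<inter> space N)) = prob (X -` A \<inter> space N) * prob (Y -` B \<inter> space N)"
      by (intro indep_setD[OF ind] in_vimage_algebra) measurable
    moreover have "(\<lambda>\<omega>. (X \<omega>, Y \<omega>)) -` (A \<times> B) \<inter> space N = (X -` A \<inter> space N) \<inter> (Y -` B \<inter> space N)"
      by auto
    ultimately show "emeasure (distr N K X) A * emeasure (distr N L Y) B
        = emeasure (distr N (K \<Otimes>\<^sub>M L) (\<lambda>\<omega>. (X \<omega>, Y \<omega>))) (A \<times> B)"
      by (simp add: emeasure_distr emeasure_eq_measure ennreal_mult'[symmetric])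
  qed (auto intro: X.sigma_finite_measure_axioms Y.sigma_finite_measure_axioms)
qed

text \<open>Only \<open>X\<close> is replaced by its law. The inner integral stays over
  \<open>N\<close>, so that it can be rewritten by further independence or by the density of a
  function of \<open>Y\<close>.\<close>

lemma nn_integral_indep_rv:
  assumes "prob_space N" and indep: "indep_rv N K X L Y"
    and [measurable]: "f \<in> borel_measurable (K \<Otimes>\<^sub>M L)"
  shows "(\<integral>\<^sup>+\<omega>. f (X \<omega>, Y \<omega>) \<partial>N) = (\<integral>\<^sup>+x. \<integral>\<^sup>+\<omega>. f (x, Y \<omega>) \<partial>N \<partial>distr N K X)"
proof -
  interpret prob_space N by fact
  have [measurable]: "X \<in> measurable N K" "Y \<in> measurable N L"
    using indep by (auto simp: indep_rv_def)
  interpret Y: prob_space "distr N L Y" by (rule prob_space_distr) fact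
  have "(\<integral>\<^sup>+\<omega>. f (X \<omega>, Y \<omega>) \<partial>N) = (\<integral>\<^sup>+p. f p \<partial>(distr N K X \<Otimes>\<^sub>M distr N L Y))"
    unfolding distr_Pair_indep_rv[OF assms(1,2)] by (simp add: nn_integral_distr)
  also have "\<dots> = (\<integral>\<^sup>+x. \<integral>\<^sup>+y. f (x, y) \<partial>distr N L Y \<partial>distr N K X)"
    by (rule Y.nn_integral_fst[symmetric]) simp
  also have "\<dots> = (\<integral>\<^sup>+x. \<integral>\<^sup>+\<omega>. f (x, Y \<omega>) \<partial>N \<partial>distr N K X)"
    by (intro nn_integral_cong) (simp add: nn_integral_distr)
  finally show ?thesis .
qed

text \<open>The convolution enters as the pointwise hypothesis \<open>conv\<close>, so that a closed
  form \<open>k\<close> can be named as the density.\<close>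

lemma (in prob_space) distributed_add_indep:
  fixes X Y :: "'a \<Rightarrow> 'b::euclidean_space"
  assumes X: "distributed M lborel X f" and Y: "distributed M lborel Y g"
    and indep: "indep_var borel X borel Y"
    and [measurable]: "k \<in> borel_measurable borel"
    and conv: "\<And>z. (\<integral>\<^sup>+w. f (z - w) * g w \<partial>lborel) = k z"
  shows "distributed M lborel (\<lambda>\<omega>. X \<omega> + Y \<omega>) k"
proof -
  have [measurable]: "X \<in> borel_measurable M" "Y \<in> borel_measurable M"
    "f \<in> borel_measurable borel" "g \<in> borel_measurable borel"
    using X Y by (auto simp: distributed_def)
  interpret Y: prob_space "distr M borel Y" by (rule prob_space_distr) simp
  have joint: "distr M borel X \<Otimes>\<^sub>M distr M borel Y = distr M (borel \<Otimes>\<^sub>M borel) (\<lambda>\<omega>. (X \<omega>, Y \<omega>))"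
    using indep unfolding indep_var_distribution_eq by simp
  have "distr M lborel (\<lambda>\<omega>. X \<omega> + Y \<omega>) = density lborel k"
  proof (rule measure_eqI)
    fix A assume "A \<in> sets (distr M lborel (\<lambda>\<omega>. X \<omega> + Y \<omega>))"
    then have [measurable]: "A \<in> sets borel" by simp
    have "emeasure (distr M lborel (\<lambda>\<omega>. X \<omega> + Y \<omega>)) A = (\<integral>\<^sup>+\<omega>. indicator A (X \<omega> + Y \<omega>) \<partial>M)"
      by (subst nn_integral_indicator[symmetric], simp, subst nn_integral_distr) simp_all
    also have "\<dots> = (\<integral>\<^sup>+p. indicator A (fst p + snd p) \<partial>(distr M borel X \<Otimes>\<^sub>M distr M borel Y))"
      unfolding joint by (simp add: nn_integral_distr)
    also have "\<dots> = (\<integral>\<^sup>+x. \<integral>\<^sup>+y. indicator A (x + y) \<partial>distr M borel Y \<partial>distr M borel X)"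
      by (subst Y.nn_integral_fst[symmetric]) simp_all
    also have "\<dots> = (\<integral>\<^sup>+x. f x * (\<integral>\<^sup>+y. g y * indicator A (x + y) \<partial>lborel) \<partial>lborel)"
    proof -
      have "(\<integral>\<^sup>+y. indicator A (x + y) \<partial>distr M borel Y) = (\<integral>\<^sup>+y. g y * indicator A (x + y) \<partial>lborel)" for x
        by (subst distributed_nn_integral[OF Y]) (simp_all add: nn_integral_distr)
      then show ?thesis
        by (subst distributed_nn_integral[OF X]) (simp_all add: nn_integral_distr)
    qed
    also have "\<dots> = (\<integral>\<^sup>+x. \<integral>\<^sup>+y. f x * g y * indicator A (x + y) \<partial>lborel \<partial>lborel)"
      by (simp add: nn_integral_cmult[symmetric] mult.assoc)
    also have "\<dots> = (\<integral>\<^sup>+y. \<integral>\<^sup>+x. f x * g y * indicator A (x + y) \<partial>lborel \<partial>lborel)"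
      by (rule lborel_pair.Fubini') measurable
    also have "\<dots> = (\<integral>\<^sup>+y. \<integral>\<^sup>+z. f (z - y) * g y * indicator A z \<partial>lborel \<partial>lborel)"
      using nn_integral_lborel_shift[of "\<lambda>z. f (z - y) * g y * indicator A z" y for y]
      by (simp add: add.commute)
    also have "\<dots> = (\<integral>\<^sup>+z. \<integral>\<^sup>+y. f (z - y) * g y * indicator A z \<partial>lborel \<partial>lborel)"
      by (rule lborel_pair.Fubini') measurable
    also have "\<dots> = (\<integral>\<^sup>+z. k z * indicator A z \<partial>lborel)"
      by (simp add: nn_integral_multc conv)
    also have "\<dots> = emeasure (density lborel k) A"
      by (simp add: emeasure_density)
    finally show "emeasure (distr M lborel (\<lambda>\<omega>. X \<omega> + Y \<omega>)) A = emeasure (density lborel k) A" .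
  qed simp
  then show ?thesis by (simp add: distributed_def)
qed

lemma borel_measurable_cgauss_mixture_density [measurable]:
  "cgauss_mixture_density p lam \<sigma> \<in> borel_measurable borel"
  unfolding cgauss_mixture_density_def[abs_def] by measurable

text \<open>Linearity in the mixture. With \<open>a\<close> the noise variance, this is the origin
  of the sums of variances in the busy-state \<beta>.\<close>

lemma cgauss_mixture_convolution:
  assumes "0 < a" "\<And>l. l \<in> {1..p} \<Longrightarrow> 0 < (\<sigma> l)\<^sup>2" "\<And>l. l \<in> {1..p} \<Longrightarrow> 0 \<le> lam l"
  shows "(\<integral>\<^sup>+w. ennreal (cgauss_density a (z - w)) * ennreal (cgauss_mixture_density p lam \<sigma> w) \<partial>lborel)
    = ennreal (\<Sum>l=1..p. lam l * cgauss_density ((\<sigma> l)\<^sup>2 + a) z)"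
proof -
  have "(\<integral>\<^sup>+w. ennreal (cgauss_density a (z - w)) * ennreal (cgauss_mixture_density p lam \<sigma> w) \<partial>lborel)
    = (\<integral>\<^sup>+w. (\<Sum>l=1..p. ennreal (lam l) * (ennreal (cgauss_density a (z - w)) * ennreal (cgauss_density ((\<sigma> l)\<^sup>2) w))) \<partial>lborel)"
  proof (rule nn_integral_cong)
    fix w
    have "ennreal (cgauss_mixture_density p lam \<sigma> w) = (\<Sum>l=1..p. ennreal (lam l) * ennreal (cgauss_density ((\<sigma> l)\<^sup>2) w))"
      unfolding cgauss_mixture_density_def using assms(2,3)
      by (subst sum_ennreal[symmetric]) (auto simp: ennreal_mult cgauss_density_nonneg intro!: sum.cong)
    then show "ennreal (cgauss_density a (z - w)) * ennreal (cgauss_mixture_density p lam \<sigma> w)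
      = (\<Sum>l=1..p. ennreal (lam l) * (ennreal (cgauss_density a (z - w)) * ennreal (cgauss_density ((\<sigma> l)\<^sup>2) w)))"
      by (simp add: sum_distrib_left ac_simps)
  qed
  also have "\<dots> = (\<Sum>l=1..p. ennreal (lam l) * ennreal (cgauss_density (a + (\<sigma> l)\<^sup>2) z))"
    using assms(1,2) by (simp add: nn_integral_sum nn_integral_cmult cgauss_density_convolution)
  also have "\<dots> = ennreal (\<Sum>l=1..p. lam l * cgauss_density ((\<sigma> l)\<^sup>2 + a) z)"
    using assms by (subst sum_ennreal[symmetric])
      (auto simp: ennreal_mult cgauss_density_nonneg add_pos_pos add.commute intro!: sum.cong)
  finally show ?thesis .
qed

text \<open>The state is the fixed parameter \<open>j\<close> and not \<open>state \<omega>\<close>,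
  so that the disturbance is a function of \<open>n\<close> and \<open>w\<close> alone and inherits
  their independence of the symbol.\<close>

definition disturbance :: "channel \<Rightarrow> ('a \<Rightarrow> complex) \<Rightarrow> ('a \<Rightarrow> complex) \<Rightarrow> 'a \<Rightarrow> complex" where
  "disturbance j n w \<omega> = n \<omega> + (if j = Busy then w \<omega> else 0)"

text \<open>Serves both true states alike; only the disturbance density \<open>k\<close> differs.
  Independence of \<open>S\<close> from \<open>n\<close> and \<open>w\<close> is conditional on
  decision and state, while that of \<open>h\<close> is stated under the unconditional
  measure.\<close>

locale osa_state = prob_space M
  for M :: "'a measure" and state decision :: "'a \<Rightarrow> channel"
    and S h n w :: "'a \<Rightarrow> complex" and j :: channel and k :: "complex \<Rightarrow> real" +
  assumes measurable_state [measurable]: "state \<in> measurable M (count_space UNIV)"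
    and measurable_decision [measurable]: "decision \<in> measurable M (count_space UNIV)"
    and measurable_symbol [measurable]: "S \<in> borel_measurable M"
    and measurable_fading [measurable]: "h \<in> borel_measurable M"
    and measurable_noise [measurable]: "n \<in> borel_measurable M"
    and measurable_interference [measurable]: "w \<in> borel_measurable M"
    and pos: "0 < \<P>(\<omega> in M. decision \<omega> = Idle \<and> state \<omega> = j)"
    and symbol_indep: "indep_rv (given_idle M state decision j) borel S (borel \<Otimes>\<^sub>M borel) (\<lambda>\<omega>. (n \<omega>, w \<omega>))"
    and fading_indep:
      "indep_rv M borel h
         (count_space UNIV \<Otimes>\<^sub>M count_space UNIV \<Otimes>\<^sub>M borel \<Otimes>\<^sub>M borel \<Otimes>\<^sub>M borel)
         (\<lambda>\<omega>. (state \<omega>, decision \<omega>, S \<omega>, n \<omega>, w \<omega>))"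
    and disturbance_distributed:
      "distributed (given_idle M state decision j) lborel (disturbance j n w) (\<lambda>z. ennreal (k z))"
    and k_measurable [measurable]: "k \<in> borel_measurable borel"
    and k_nonneg: "0 \<le> k z"
begin

abbreviation "N \<equiv> given_idle M state decision j"
abbreviation "H \<equiv> distr M borel h"

lemma measurable_disturbance [measurable]: "disturbance j n w \<in> borel_measurable M"
  unfolding disturbance_def by measurable

lemma measurable_received [measurable]: "osa_received state decision S h n w \<in> borel_measurable M"
  unfolding osa_received_def by measurable

lemma sets_N [measurable_cong]: "sets N = sets M"
  by (simp add: given_idle_def)

lemma prob_space_N: "prob_space N"
  unfolding given_idle_def using pos
  by (intro prob_space_uniform_measure) (simp_all add: emeasure_eq_measure)

lemma prob_space_H: "prob_space H"
  by (rule prob_space_distr) simp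

lemma nn_integral_k: "(\<integral>\<^sup>+z. ennreal (k z) \<partial>lborel) = 1"
  using distributed_nn_integral[OF disturbance_distributed, of "\<lambda>_. 1"]
    prob_space.emeasure_space_1[OF prob_space_N] by simp

lemma received_eq: "AE \<omega> in N. osa_received state decision S h n w \<omega> = h \<omega> * S \<omega> + disturbance j n w \<omega>"
  unfolding given_idle_def
  by (rule AE_uniform_measureI) (auto simp: osa_received_def disturbance_def)

text \<open>Given idle decision and state, the symbol, fading and disturbance factor, and the fading
  keeps its unconditional law \<open>H\<close>. The conditioning event depends on state and decision
  only, and \<open>h\<close> is independent of these jointly with symbol, noise and
  interference.\<close>

lemma nn_integral_symbol:
  assumes [measurable]: "u \<in> borel_measurable (borel \<Otimes>\<^sub>M borel)"
  shows "(\<integral>\<^sup>+\<omega>. indicator {s} (S \<omega>) * u (h \<omega>, disturbance j n w \<omega>) \<partial>N)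
    = ennreal \<P>(\<omega> in N. S \<omega> = s) * (\<integral>\<^sup>+g. \<integral>\<^sup>+z. ennreal (k z) * u (g, z) \<partial>lborel \<partial>H)"
proof -
  define A where "A = {\<omega> \<in> space M. decision \<omega> = Idle \<and> state \<omega> = j}"
  have [measurable]: "A \<in> sets M" unfolding A_def by measurable
  have N_eq: "N = uniform_measure M A" by (simp add: given_idle_def A_def)
  have posA: "emeasure M A \<noteq> 0" using pos by (simp add: A_def emeasure_eq_measure)
  have A_top: "emeasure M A \<noteq> \<infinity>" by (simp add: emeasure_eq_measure)
  interpret N: prob_space N by (rule prob_space_N)
  define I where "I = (\<integral>\<^sup>+g. \<integral>\<^sup>+z. ennreal (k z) * u (g, z) \<partial>lborel \<partial>distr M borel h)"
  \<comment> \<open>With the fading frozen at \<open>g\<close>, the conditional independence of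
    symbol and disturbance suffices.\<close>
  have inner: "(\<integral>\<^sup>+\<omega>. indicator {s} (S \<omega>) * u (g, disturbance j n w \<omega>) \<partial>N)
    = ennreal \<P>(\<omega> in N. S \<omega> = s) * (\<integral>\<^sup>+z. ennreal (k z) * u (g, z) \<partial>lborel)" for g
  proof -
    let ?f = "\<lambda>(s', n', w'). indicator {s} s' * u (g, n' + (if j = Busy then w' else 0))"
    have "(\<integral>\<^sup>+\<omega>. indicator {s} (S \<omega>) * u (g, disturbance j n w \<omega>) \<partial>N)
      = (\<integral>\<^sup>+\<omega>. ?f (S \<omega>, (n \<omega>, w \<omega>)) \<partial>N)"
      by (simp add: disturbance_def)
    also have "\<dots> = (\<integral>\<^sup>+s'. \<integral>\<^sup>+\<omega>. ?f (s', (n \<omega>, w \<omega>)) \<partial>N \<partial>distr N borel S)"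
      by (rule nn_integral_indep_rv[OF N.prob_space_axioms symbol_indep]) measurable
    also have "\<dots> = (\<integral>\<^sup>+s'. indicator {s} s' * (\<integral>\<^sup>+\<omega>. u (g, disturbance j n w \<omega>) \<partial>N) \<partial>distr N borel S)"
      by (simp add: nn_integral_cmult disturbance_def)
    also have "\<dots> = emeasure (distr N borel S) {s} * (\<integral>\<^sup>+\<omega>. u (g, disturbance j n w \<omega>) \<partial>N)"
      by (subst nn_integral_multc) simp_all
    also have "emeasure (distr N borel S) {s} = ennreal \<P>(\<omega> in N. S \<omega> = s)"
      by (subst emeasure_distr) (auto simp: N.emeasure_eq_measure intro!: arg_cong[where f=N.prob])
    also have "(\<integral>\<^sup>+\<omega>. u (g, disturbance j n w \<omega>) \<partial>N) = (\<integral>\<^sup>+z. ennreal (k z) * u (g, z) \<partial>lborel)"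
      by (rule distributed_nn_integral[OF disturbance_distributed, symmetric]) simp
    finally show ?thesis .
  qed
  \<comment> \<open>The conditioning event is moved into the integrand, as a function of the second
    variable in \<open>fading_indep\<close>.\<close>
  let ?F = "\<lambda>(g, st, de, s', n', w'). indicator {s} s' * u (g, n' + (if j = Busy then w' else 0)) *
     indicator {p. snd p = Idle \<and> fst p = j} (st, de)"
  have [measurable]: "{p. snd p = Idle \<and> fst p = j} \<in> sets (count_space UNIV \<Otimes>\<^sub>M count_space UNIV)"
  proof -
    have "{p. snd p = Idle \<and> fst p = j} = {j} \<times> {Idle}" by auto
    also have "\<dots> \<in> sets (count_space UNIV \<Otimes>\<^sub>M count_space UNIV)"
      by (rule pair_measureI) auto
    finally show ?thesis .
  qed
  have A_ind: "indicator A \<omega> = (indicator {p. snd p = Idle \<and> fst p = j} (state \<omega>, decision \<omega>) :: ennreal)" if "\<omega> \<in> space M" for \<omega>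
    using that by (simp add: A_def indicator_def)
  have "(\<integral>\<^sup>+\<omega>. indicator {s} (S \<omega>) * u (h \<omega>, disturbance j n w \<omega>) * indicator A \<omega> \<partial>M)
    = (\<integral>\<^sup>+\<omega>. ?F (h \<omega>, (state \<omega>, decision \<omega>, S \<omega>, n \<omega>, w \<omega>)) \<partial>M)"
    by (intro nn_integral_cong) (simp add: disturbance_def A_ind)
  also have "\<dots> = (\<integral>\<^sup>+g. \<integral>\<^sup>+\<omega>. ?F (g, (state \<omega>, decision \<omega>, S \<omega>, n \<omega>, w \<omega>)) \<partial>M \<partial>distr M borel h)"
    by (rule nn_integral_indep_rv[OF prob_space_axioms fading_indep]) measurable
  also have "\<dots> = (\<integral>\<^sup>+g. \<integral>\<^sup>+\<omega>. indicator {s} (S \<omega>) * u (g, disturbance j n w \<omega>) * indicator A \<omega> \<partial>M \<partial>distr M borel h)"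
    by (intro nn_integral_cong) (simp add: disturbance_def A_ind)
  also have "\<dots> = (\<integral>\<^sup>+g. emeasure M A * (ennreal \<P>(\<omega> in N. S \<omega> = s) * (\<integral>\<^sup>+z. ennreal (k z) * u (g, z) \<partial>lborel)) \<partial>distr M borel h)"
  proof (rule nn_integral_cong)
    fix g
    have "(\<integral>\<^sup>+\<omega>. indicator {s} (S \<omega>) * u (g, disturbance j n w \<omega>) * indicator A \<omega> \<partial>M)
      = emeasure M A * (\<integral>\<^sup>+\<omega>. indicator {s} (S \<omega>) * u (g, disturbance j n w \<omega>) \<partial>N)"
      unfolding N_eq using posA A_top
      by (subst nn_integral_uniform_measure) (simp_all add: ennreal_times_divide mult.commute[of "emeasure M A"] ennreal_mult_divide_eq)
    then show "(\<integral>\<^sup>+\<omega>. indicator {s} (S \<omega>) * u (g, disturbance j n w \<omega>) * indicator A \<omega> \<partial>M)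
      = emeasure M A * (ennreal \<P>(\<omega> in N. S \<omega> = s) * (\<integral>\<^sup>+z. ennreal (k z) * u (g, z) \<partial>lborel))"
      by (simp add: inner)
  qed
  also have "\<dots> = emeasure M A * (ennreal \<P>(\<omega> in N. S \<omega> = s) * I)"
    by (simp add: nn_integral_cmult I_def)
  finally have "(\<integral>\<^sup>+\<omega>. indicator {s} (S \<omega>) * u (h \<omega>, disturbance j n w \<omega>) * indicator A \<omega> \<partial>M) = \<dots>" .
  then have "(\<integral>\<^sup>+\<omega>. indicator {s} (S \<omega>) * u (h \<omega>, disturbance j n w \<omega>) \<partial>N)
    = emeasure M A * (ennreal \<P>(\<omega> in N. S \<omega> = s) * I) / emeasure M A"
    unfolding N_eq by (subst nn_integral_uniform_measure) simp_all
  also have "\<dots> = ennreal \<P>(\<omega> in N. S \<omega> = s) * I"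
    using posA A_top by (simp add: mult.commute[of "emeasure M A"] ennreal_mult_divide_eq)
  finally show ?thesis by (simp add: I_def)
qed

lemma nn_integral_symbol_fading:
  assumes [measurable]: "R \<in> borel_measurable borel"
  shows "(\<integral>\<^sup>+\<omega>. indicator {s} (S \<omega>) * R (h \<omega>) \<partial>N) = ennreal \<P>(\<omega> in N. S \<omega> = s) * (\<integral>\<^sup>+g. R g \<partial>H)"
  using nn_integral_symbol[of "\<lambda>p. R (fst p)" s]
  by (simp add: nn_integral_multc nn_integral_k)

text \<open>Multiplied by the probability of \<open>s\<close>, the integrals of
  \<open>f s g y\<close> and of \<open>k (y - g * s)\<close> over any measurable set of pairs (g, y)
  both give the probability that \<open>s\<close> is sent and the fading and received value lie in
  that set. The factor is positive and cancels, and densities with equal integrals agree almost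
  everywhere.\<close>

lemma cond_density_eq_AE:
  assumes cd: "has_cond_density N (borel \<Otimes>\<^sub>M borel) (\<lambda>\<omega>. (S \<omega>, h \<omega>)) lborel
      (osa_received state decision S h n w) (\<lambda>(s, g) y. f s g y)"
    and s: "0 < \<P>(\<omega> in N. S \<omega> = s)"
  shows "AE g in H. AE y in lborel. f s g y = k (y - g * s)"
proof -
  interpret H: prob_space H by (rule prob_space_H)
  interpret HL: pair_sigma_finite H "lborel :: complex measure" ..
  let ?Y = "osa_received state decision S h n w"
  let ?c = "ennreal \<P>(\<omega> in N. S \<omega> = s)"
  have f0: "0 \<le> f s' g y" for s' g y
    using cd by (simp add: has_cond_density_def)
  have dist: "distributed N (distr N (borel \<Otimes>\<^sub>M borel) (\<lambda>\<omega>. (S \<omega>, h \<omega>)) \<Otimes>\<^sub>M lborel)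
      (\<lambda>\<omega>. ((S \<omega>, h \<omega>), ?Y \<omega>)) (\<lambda>z. ennreal (f (fst (fst z)) (snd (fst z)) (snd z)))"
    using cd by (simp add: has_cond_density_def split_beta)
  have fm [measurable]: "(\<lambda>z. ennreal (f (fst (fst z)) (snd (fst z)) (snd z))) \<in> borel_measurable ((borel \<Otimes>\<^sub>M borel) \<Otimes>\<^sub>M borel)"
  proof -
    have sets_eq: "sets (distr N (borel \<Otimes>\<^sub>M borel) (\<lambda>\<omega>. (S \<omega>, h \<omega>)) \<Otimes>\<^sub>M lborel) = sets ((borel \<Otimes>\<^sub>M borel) \<Otimes>\<^sub>M borel)"
      by (intro sets_pair_measure_cong) simp_all
    show ?thesis
      using dist unfolding distributed_def by (simp add: measurable_cong_sets[OF sets_eq refl])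
  qed
  have fs [measurable]: "(\<lambda>p. ennreal (f s (fst p) (snd p))) \<in> borel_measurable (borel \<Otimes>\<^sub>M borel)"
    using measurable_compose[OF _ fm, of "\<lambda>p. ((s, fst p), snd p)" "borel \<Otimes>\<^sub>M borel"] by simp
  have "AE p in H \<Otimes>\<^sub>M lborel. ennreal (f s (fst p) (snd p)) = ennreal (k (snd p - fst p * s))"
  proof (rule HL.density_unique2)
    fix A assume "A \<in> sets (H \<Otimes>\<^sub>M (lborel :: complex measure))"
    then have A [measurable]: "A \<in> sets (borel \<Otimes>\<^sub>M borel)" by simp
    define R where "R g = (\<integral>\<^sup>+y. ennreal (f s g y) * indicator A (g, y) \<partial>lborel)" for g
    have [measurable]: "R \<in> borel_measurable borel"
    proof -
      have "(\<lambda>p. ennreal (f s (fst p) (snd p)) * indicator A p) \<in> borel_measurable (borel \<Otimes>\<^sub>M lborel)"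
        by measurable
      from lborel.borel_measurable_nn_integral_fst[OF this] show ?thesis
        by (simp add: R_def[abs_def])
    qed
    have "?c * (\<integral>\<^sup>+g. R g \<partial>H) = (\<integral>\<^sup>+\<omega>. indicator {s} (S \<omega>) * R (h \<omega>) \<partial>N)"
      by (rule nn_integral_symbol_fading[symmetric]) simp
    also have "\<dots> = (\<integral>\<^sup>+x. indicator {s} (fst x) * R (snd x) \<partial>distr N (borel \<Otimes>\<^sub>M borel) (\<lambda>\<omega>. (S \<omega>, h \<omega>)))"
      by (simp add: nn_integral_distr)
    also have "\<dots> = (\<integral>\<^sup>+x. \<integral>\<^sup>+y. ennreal (f (fst x) (snd x) y) * (indicator {s} (fst x) * indicator A (snd x, y)) \<partial>lborel
        \<partial>distr N (borel \<Otimes>\<^sub>M borel) (\<lambda>\<omega>. (S \<omega>, h \<omega>)))"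
      by (intro nn_integral_cong) (auto simp: R_def split: split_indicator)
    also have "\<dots> = (\<integral>\<^sup>+z. ennreal (f (fst (fst z)) (snd (fst z)) (snd z)) * (indicator {s} (fst (fst z)) * indicator A (snd (fst z), snd z))
        \<partial>(distr N (borel \<Otimes>\<^sub>M borel) (\<lambda>\<omega>. (S \<omega>, h \<omega>)) \<Otimes>\<^sub>M lborel))"
      by (subst lborel.nn_integral_fst[symmetric]) simp_all
    also have "\<dots> = (\<integral>\<^sup>+\<omega>. indicator {s} (S \<omega>) * indicator A (h \<omega>, ?Y \<omega>) \<partial>N)"
      by (subst distributed_nn_integral[OF dist]) simp_all
    also have "\<dots> = (\<integral>\<^sup>+\<omega>. indicator {s} (S \<omega>) * indicator A (h \<omega>, h \<omega> * s + disturbance j n w \<omega>) \<partial>N)"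
      using received_eq by (intro nn_integral_cong_AE, eventually_elim) (auto split: split_indicator)
    also have "\<dots> = ?c * (\<integral>\<^sup>+g. \<integral>\<^sup>+z. ennreal (k z) * indicator A (g, g * s + z) \<partial>lborel \<partial>H)"
      using nn_integral_symbol[of "\<lambda>p. indicator A (fst p, fst p * s + snd p)" s] by simp
    also have "\<dots> = ?c * (\<integral>\<^sup>+g. \<integral>\<^sup>+y. ennreal (k (y - g * s)) * indicator A (g, y) \<partial>lborel \<partial>H)"
      using nn_integral_lborel_shift[of "\<lambda>y. ennreal (k (y - g * s)) * indicator A (g, y)" "g * s" for g]
      by simp
    finally have "(\<integral>\<^sup>+g. R g \<partial>H) = (\<integral>\<^sup>+g. \<integral>\<^sup>+y. ennreal (k (y - g * s)) * indicator A (g, y) \<partial>lborel \<partial>H)"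
      using s by (subst (asm) ennreal_mult_cancel_left) auto
    then show "(\<integral>\<^sup>+p\<in>A. ennreal (f s (fst p) (snd p)) \<partial>(H \<Otimes>\<^sub>M lborel)) = (\<integral>\<^sup>+p\<in>A. ennreal (k (snd p - fst p * s)) \<partial>(H \<Otimes>\<^sub>M lborel))"
      by (simp add: lborel.nn_integral_fst[symmetric] R_def)
  qed simp_all
  then have "AE p in H \<Otimes>\<^sub>M lborel. f s (fst p) (snd p) = k (snd p - fst p * s)"
    by eventually_elim (use f0 k_nonneg in simp)
  then show ?thesis
    using HL.AE_pair[of "\<lambda>p. f s (fst p) (snd p) = k (snd p - fst p * s)"] by simp
qed

end

subsection \<open>Optimal detection\<close>

text \<open>The region is described for the disturbance \<open>y - g * s\<close> and not for
  \<open>y\<close>, so that the same centred density serves all symbols.\<close>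

definition nearest_region :: "complex set \<Rightarrow> complex \<Rightarrow> complex \<Rightarrow> complex set" where
  "nearest_region C g s = {z. \<forall>s'\<in>C. cmod z \<le> cmod (z + g * (s - s'))}"

lemma sets_nearest_region [measurable]: "nearest_region C g s \<in> sets borel"
  unfolding nearest_region_def by (rule sets_nearest)

lemma measurable_indicator_nearest_region [measurable (raw)]:
  assumes "finite C" and [measurable]: "g \<in> borel_measurable M" "z \<in> borel_measurable M"
  shows "(\<lambda>x. indicator (nearest_region C (g x) s) (z x) :: ennreal) \<in> borel_measurable M"
proof -
  have [measurable]: "Measurable.pred M (\<lambda>x. \<forall>s'\<in>C. cmod (z x) \<le> cmod (z x + g x * (s - s')))"
    using assms(1) by (intro pred_intros_finite) simp_all
  have "(\<lambda>x. indicator (nearest_region C (g x) s) (z x) :: ennreal)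
      = (\<lambda>x. if \<forall>s'\<in>C. cmod (z x) \<le> cmod (z x + g x * (s - s')) then 1 else 0)"
    by (auto simp: nearest_region_def indicator_def)
  also have "\<dots> \<in> borel_measurable M" by measurable
  finally show ?thesis .
qed

text \<open>Ties lie on the perpendicular bisector of \<open>a\<close> and \<open>b\<close>, a
  hyperplane.\<close>

lemma AE_cmod_neq:
  fixes a b :: complex
  assumes "a \<noteq> b"
  shows "AE y in lborel. cmod (y - a) \<noteq> cmod (y - b)"
proof -
  have "{y. cmod (y - a) = cmod (y - b)} = {y. (2 *\<^sub>R (b - a)) \<bullet> y = b \<bullet> b - a \<bullet> a}"
    unfolding norm_eq by (auto simp: algebra_simps inner_commute)
  also have "negligible \<dots>"
    using assms by (intro negligible_hyperplane) simp
  finally have "{y. cmod (y - a) = cmod (y - b)} \<in> null_sets lebesgue"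
    by (simp add: negligible_iff_null_sets)
  \<comment> \<open>\<open>negligible\<close> refers to the completed measure; as a closed set the
    bisector is Borel and so null for \<open>lborel\<close> itself.\<close>
  moreover have "closed {y. cmod (y - a) = cmod (y - b)}"
    by (intro closed_Collect_eq continuous_intros)
  ultimately have "{y. cmod (y - a) = cmod (y - b)} \<in> null_sets lborel"
    by (simp add: null_sets_completion_iff)
  then show ?thesis
    by (rule AE_I') auto
qed

text \<open>Maximising a strictly decreasing function of distance means choosing a nearest point.
  For \<open>g \<noteq> 0\<close> the points \<open>g * s\<close> are distinct, and almost no
  \<open>y\<close> ties two of them, so the nearest point is unique however \<open>D\<close> breaks
  ties.\<close>

lemma map_detector_nearest:
  assumes "finite C" "is_map_detector C post f D" "g \<noteq> 0"
    and metric: "AE y in lborel. \<forall>s\<in>C. post Idle * f Idle s g y + post Busy * f Busy s g y = \<Phi> (cmod (y - g * s))"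
    and decreasing: "\<And>a b. 0 \<le> a \<Longrightarrow> a < b \<Longrightarrow> \<Phi> b < (\<Phi> a :: real)"
  shows "AE y in lborel. \<forall>s\<in>C. D g y = s \<longleftrightarrow> (\<forall>s'\<in>C. cmod (y - g * s) \<le> cmod (y - g * s'))"
proof -
  have "AE y in lborel. \<forall>s\<in>C. \<forall>s'\<in>C. s \<noteq> s' \<longrightarrow> cmod (y - g * s) \<noteq> cmod (y - g * s')"
    using assms(1,3) AE_cmod_neq by (auto simp: AE_finite_all)
  with metric show ?thesis
  proof eventually_elim
    case (elim y)
    have D: "D g y \<in> C" "\<And>s. s \<in> C \<Longrightarrow> post Idle * f Idle s g y + post Busy * f Busy s g y
        \<le> post Idle * f Idle (D g y) g y + post Busy * f Busy (D g y) g y"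
      using assms(2) unfolding is_map_detector_def by auto
    have D2: "\<Phi> (cmod (y - g * s)) \<le> \<Phi> (cmod (y - g * D g y))" if "s \<in> C" for s
      using D(2)[OF that] unfolding elim(1)[rule_format, OF that] elim(1)[rule_format, OF D(1)] .
    have near: "cmod (y - g * D g y) \<le> cmod (y - g * s)" if "s \<in> C" for s
      using D2[OF that] decreasing[of "cmod (y - g * s)" "cmod (y - g * D g y)"] by force
    show ?case
    proof (intro ballI iffI)
      fix s assume "s \<in> C" "\<forall>s'\<in>C. cmod (y - g * s) \<le> cmod (y - g * s')"
      then have "cmod (y - g * s) = cmod (y - g * D g y)"
        using near D(1) by (simp add: order_antisym)
      then show "D g y = s" using elim(2) \<open>s \<in> C\<close> D(1) by metis
    qed (use near in auto)
  qed
qed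

context osa_state
begin

text \<open>\<open>nn_integral_symbol\<close> splits off the prior of each symbol; translation by
  \<open>g * s\<close> then turns the decision region for \<open>y\<close> into one for the
  disturbance.\<close>

lemma prob_correct:
  assumes C: "finite C" "C \<noteq> {}"
    and uniform: "\<And>s. s \<in> C \<Longrightarrow> \<P>(\<omega> in N. S \<omega> = s) = 1 / real (card C)"
    and D_measurable [measurable]: "(\<lambda>(h, y). D h y) \<in> borel_measurable (borel \<Otimes>\<^sub>M borel)"
    and D: "AE g in H. AE y in lborel. \<forall>s\<in>C. D g y = s \<longleftrightarrow> (\<forall>s'\<in>C. cmod (y - g * s) \<le> cmod (y - g * s'))"
  shows "emeasure N {\<omega> \<in> space N. D (h \<omega>) (osa_received state decision S h n w \<omega>) = S \<omega>}
    = ennreal (1 / real (card C)) * (\<Sum>s\<in>C. \<integral>\<^sup>+g. \<integral>\<^sup>+z. ennreal (k z) * indicator (nearest_region C g s) z \<partial>lborel \<partial>H)"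
proof -
  interpret N: prob_space N by (rule prob_space_N)
  let ?Y = "osa_received state decision S h n w"
  have [measurable]: "(\<lambda>x. D (a x) (b x)) \<in> borel_measurable L"
    if [measurable]: "a \<in> borel_measurable L" "b \<in> borel_measurable L" for a b and L :: "'c measure"
    using measurable_compose[OF measurable_Pair[OF that] D_measurable] by simp
  have [measurable]: "C \<in> sets borel"
    using C(1) by (simp add: finite_imp_closed)
  \<comment> \<open>The point masses on \<open>C\<close> already add up to 1, so the symbol lies in
    \<open>C\<close> almost surely.\<close>
  have "N.prob {\<omega> \<in> space N. S \<omega> \<in> C} = (\<Sum>s\<in>C. N.prob {\<omega> \<in> space N. S \<omega> = s})"
  proof -
    have "{\<omega> \<in> space N. S \<omega> \<in> C} = (\<Union>s\<in>C. {\<omega> \<in> space N. S \<omega> = s})" by auto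
    then show ?thesis
      using C(1) by (simp only:) (rule N.finite_measure_finite_Union, auto simp: disjoint_family_on_def)
  qed
  also have "\<dots> = 1" using C by (simp add: uniform)
  finally have SC: "AE \<omega> in N. S \<omega> \<in> C"
    by (subst N.prob_Collect_eq_1[symmetric]) simp_all
  have "emeasure N {\<omega> \<in> space N. D (h \<omega>) (?Y \<omega>) = S \<omega>} = (\<integral>\<^sup>+\<omega>. indicator {\<omega> \<in> space N. D (h \<omega>) (?Y \<omega>) = S \<omega>} \<omega> \<partial>N)"
    by simp
  \<comment> \<open>Only the summand with \<open>s\<close> equal to the sent symbol can be nonzero;
    writing \<open>h \<omega> * s\<close> in it fixes \<open>s\<close>, as
    \<open>nn_integral_symbol\<close> requires.\<close>
  also have "\<dots> = (\<integral>\<^sup>+\<omega>. (\<Sum>s\<in>C. indicator {s} (S \<omega>) * indicator {s} (D (h \<omega>) (h \<omega> * s + disturbance j n w \<omega>))) \<partial>N)"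
    using SC received_eq AE_space
  proof (intro nn_integral_cong_AE, eventually_elim)
    fix \<omega> assume elim: "S \<omega> \<in> C" "?Y \<omega> = h \<omega> * S \<omega> + disturbance j n w \<omega>" "\<omega> \<in> space N"
    have "(\<Sum>s\<in>C. indicator {s} (S \<omega>) * indicator {s} (D (h \<omega>) (h \<omega> * s + disturbance j n w \<omega>)) :: ennreal)
      = (\<Sum>s\<in>C. if s = S \<omega> then indicator {s} (D (h \<omega>) (h \<omega> * s + disturbance j n w \<omega>)) else 0)"
      by (intro sum.cong) (auto split: split_indicator)
    also have "\<dots> = indicator {S \<omega>} (D (h \<omega>) (h \<omega> * S \<omega> + disturbance j n w \<omega>))"
      using C elim(1) by (simp add: sum.delta)
    finally show "indicator {\<omega> \<in> space N. D (h \<omega>) (?Y \<omega>) = S \<omega>} \<omega>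
      = (\<Sum>s\<in>C. indicator {s} (S \<omega>) * indicator {s} (D (h \<omega>) (h \<omega> * s + disturbance j n w \<omega>)) :: ennreal)"
      using elim by (simp add: indicator_def)
  qed
  also have "\<dots> = (\<Sum>s\<in>C. \<integral>\<^sup>+\<omega>. indicator {s} (S \<omega>) * indicator {s} (D (h \<omega>) (h \<omega> * s + disturbance j n w \<omega>)) \<partial>N)"
    by (rule nn_integral_sum) measurable
  also have "\<dots> = (\<Sum>s\<in>C. ennreal (1 / real (card C)) * (\<integral>\<^sup>+g. \<integral>\<^sup>+z. ennreal (k z) * indicator (nearest_region C g s) z \<partial>lborel \<partial>H))"
  proof (rule sum.cong[OF refl])
    fix s assume s: "s \<in> C"
    have "(\<integral>\<^sup>+\<omega>. indicator {s} (S \<omega>) * indicator {s} (D (h \<omega>) (h \<omega> * s + disturbance j n w \<omega>)) \<partial>N)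
      = ennreal (1 / real (card C)) * (\<integral>\<^sup>+g. \<integral>\<^sup>+z. ennreal (k z) * indicator {s} (D g (g * s + z)) \<partial>lborel \<partial>H)"
      using nn_integral_symbol[of "\<lambda>p. indicator {s} (D (fst p) (fst p * s + snd p))" s] s
      by (simp add: uniform)
    also have "(\<integral>\<^sup>+g. \<integral>\<^sup>+z. ennreal (k z) * indicator {s} (D g (g * s + z)) \<partial>lborel \<partial>H)
      = (\<integral>\<^sup>+g. \<integral>\<^sup>+z. ennreal (k z) * indicator (nearest_region C g s) z \<partial>lborel \<partial>H)"
      using D
    proof (intro nn_integral_cong_AE, eventually_elim)
      fix g assume g: "AE y in lborel. \<forall>s\<in>C. D g y = s \<longleftrightarrow> (\<forall>s'\<in>C. cmod (y - g * s) \<le> cmod (y - g * s'))"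
      have "(\<integral>\<^sup>+z. ennreal (k z) * indicator {s} (D g (g * s + z)) \<partial>lborel)
        = (\<integral>\<^sup>+y. ennreal (k (y - g * s)) * indicator {s} (D g y) \<partial>lborel)"
        using nn_integral_lborel_shift[of "\<lambda>y. ennreal (k (y - g * s)) * indicator {s} (D g y)" "g * s"]
        by simp
      also have "\<dots> = (\<integral>\<^sup>+y. ennreal (k (y - g * s)) * indicator (nearest_region C g s) (y - g * s) \<partial>lborel)"
        using g
      proof (intro nn_integral_cong_AE, eventually_elim)
        fix y assume y: "\<forall>s\<in>C. D g y = s \<longleftrightarrow> (\<forall>s'\<in>C. cmod (y - g * s) \<le> cmod (y - g * s'))"
        have eq: "y - g * s + g * (s - s') = y - g * s'" for s' by (simp add: algebra_simps)
        have "y - g * s \<in> nearest_region C g s \<longleftrightarrow> D g y = s"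
          using y s unfolding nearest_region_def mem_Collect_eq eq by blast
        then show "ennreal (k (y - g * s)) * indicator {s} (D g y)
          = ennreal (k (y - g * s)) * indicator (nearest_region C g s) (y - g * s)"
          by (simp add: indicator_def)
      qed
      also have "\<dots> = (\<integral>\<^sup>+z. ennreal (k z) * indicator (nearest_region C g s) z \<partial>lborel)"
        using nn_integral_lborel_shift[of "\<lambda>y. ennreal (k (y - g * s)) * indicator (nearest_region C g s) (y - g * s)" "g * s"]
        by simp
      finally show "(\<integral>\<^sup>+z. ennreal (k z) * indicator {s} (D g (g * s + z)) \<partial>lborel)
        = (\<integral>\<^sup>+z. ennreal (k z) * indicator (nearest_region C g s) z \<partial>lborel)" .
    qed
    finally show "(\<integral>\<^sup>+\<omega>. indicator {s} (S \<omega>) * indicator {s} (D (h \<omega>) (h \<omega> * s + disturbance j n w \<omega>)) \<partial>N)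
      = ennreal (1 / real (card C)) * (\<integral>\<^sup>+g. \<integral>\<^sup>+z. ennreal (k z) * indicator (nearest_region C g s) z \<partial>lborel \<partial>H)" .
  qed
  finally show ?thesis by (simp add: sum_distrib_left)
qed

end

text \<open>Write g = u |g| with |u| = 1 and substitute u z for z: u z + g t and z + |g| t have the
  same modulus, and a radial \<open>k\<close> is unchanged.\<close>

lemma nn_integral_nearest_region_rotate:
  assumes [measurable]: "k \<in> borel_measurable borel" and k: "\<And>z. k z = k (of_real (cmod z))"
  shows "(\<integral>\<^sup>+z. ennreal (k z) * indicator (nearest_region C g s) z \<partial>lborel)
    = (\<integral>\<^sup>+z. ennreal (k z) * indicator (nearest_region C (of_real (cmod g)) s) z \<partial>lborel)"
proof (cases "g = 0")
  case False
  define u where "u = g / of_real (cmod g)"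
  have u: "cmod u = 1" "g = u * of_real (cmod g)"
    using False by (auto simp: u_def norm_divide)
  have "cmod (u * z + g * t) = cmod (z + of_real (cmod g) * t)" for z t
  proof -
    have "u * z + g * t = u * (z + of_real (cmod g) * t)"
      by (subst u(2)) (simp add: algebra_simps)
    then show ?thesis by (simp add: norm_mult u(1))
  qed
  then have "indicator (nearest_region C g s) (u * z) = (indicator (nearest_region C (of_real (cmod g)) s) z :: ennreal)" for z
    using u(1) by (simp add: nearest_region_def indicator_def norm_mult)
  moreover have "k (u * z) = k z" for z
    by (subst (1 2) k) (simp add: norm_mult u(1))
  ultimately show ?thesis
    using nn_integral_lborel_rotate[OF _ u(1), of "\<lambda>z. ennreal (k z) * indicator (nearest_region C g s) z"]
    by simp
qed simp

lemma cgauss_density_radial: "cgauss_density v z = cgauss_density v (of_real (cmod z))"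
  by (simp add: cgauss_density_def)

text \<open>After rotation the inner integral depends on the fading only through its modulus, so the
  exponential law of |h|^2 determines the average.\<close>

lemma rayleigh_nearest_region:
  assumes M: "prob_space M" and [measurable]: "h \<in> borel_measurable M"
    and Rayleigh: "distributed M lborel (\<lambda>\<omega>. (cmod (h \<omega>))\<^sup>2) (\<lambda>x. ennreal (exponential_density 1 x))"
    and qam: "1 \<le> MI" "1 \<le> MQ" "2 \<le> MI * MQ" "0 < P0" and v: "0 < v"
  defines "C \<equiv> qam_constellation MI MQ P0"
  shows "(\<Sum>s\<in>C. \<integral>\<^sup>+g. \<integral>\<^sup>+z. ennreal (cgauss_density v z) * indicator (nearest_region C g s) z \<partial>lborel \<partial>distr M borel h)
    = ennreal (real MI * real MQ * (1 - qam_error MI MQ (qam_beta MI MQ P0 v)))"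
proof -
  note dpos = qam_dmin_pos[OF qam]
  have fin: "finite C" by (simp add: C_def qam_constellation_eq)
  define T where "T s r = (\<integral>\<^sup>+z. ennreal (cgauss_density v z) * indicator (nearest_region C (of_real r) s) z \<partial>lborel)" for s and r :: real
  have [measurable]: "T s \<in> borel_measurable borel" for s
    unfolding T_def[abs_def] using fin by measurable
  let ?e = "\<lambda>x. ennreal (exponential_density 1 x)"
  let ?c = "\<lambda>x. sqrt x * qam_dmin MI MQ P0 / 2"
  have 1: "(\<integral>\<^sup>+g. \<integral>\<^sup>+z. ennreal (cgauss_density v z) * indicator (nearest_region C g s) z \<partial>lborel \<partial>distr M borel h)
    = (\<integral>\<^sup>+x. ?e x * T s (sqrt x) \<partial>lborel)" for s
  proof -
    have "(\<integral>\<^sup>+g. \<integral>\<^sup>+z. ennreal (cgauss_density v z) * indicator (nearest_region C g s) z \<partial>lborel \<partial>distr M borel h)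
      = (\<integral>\<^sup>+g. T s (cmod g) \<partial>distr M borel h)"
      unfolding T_def
      by (intro nn_integral_cong nn_integral_nearest_region_rotate cgauss_density_radial) simp
    also have "\<dots> = (\<integral>\<^sup>+\<omega>. T s (sqrt ((cmod (h \<omega>))\<^sup>2)) \<partial>M)"
      by (simp add: nn_integral_distr)
    also have "\<dots> = (\<integral>\<^sup>+x. ?e x * T s (sqrt x) \<partial>lborel)"
      by (rule distributed_nn_integral[OF Rayleigh, symmetric]) simp
    finally show ?thesis .
  qed
  have 2: "(\<integral>\<^sup>+x. ?e x * T (qam_point MI MQ P0 n q) (sqrt x) \<partial>lborel)
    = (\<integral>\<^sup>+x. ?e x * ennreal (pam_correct (sqrt v) MI (?c x) n * pam_correct (sqrt v) MQ (?c x) q) \<partial>lborel)"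
    if "n < MI" "q < MQ" for n q
    \<comment> \<open>The cell formula needs a positive gain: \<open>x = 0\<close> is null, and the
      density vanishes for negative \<open>x\<close>.\<close>
    using AE_lborel_singleton[of 0]
  proof (intro nn_integral_cong_AE, eventually_elim)
    fix x :: real assume x: "x \<noteq> 0"
    show "?e x * T (qam_point MI MQ P0 n q) (sqrt x)
      = ?e x * ennreal (pam_correct (sqrt v) MI (?c x) n * pam_correct (sqrt v) MQ (?c x) q)"
    proof (cases "0 < x")
      case True
      then show ?thesis
        using nn_integral_cgauss_qam_cell[OF v _ dpos(2) that, of "sqrt x"]
        unfolding T_def C_def nearest_region_def by simp
    qed (use x in \<open>simp add: exponential_density_def\<close>)
  qed
  have "(\<Sum>s\<in>C. \<integral>\<^sup>+g. \<integral>\<^sup>+z. ennreal (cgauss_density v z) * indicator (nearest_region C g s) z \<partial>lborel \<partial>distr M borel h)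
    = (\<Sum>(n, q)\<in>{..<MI} \<times> {..<MQ}. \<integral>\<^sup>+x. ?e x * T (qam_point MI MQ P0 n q) (sqrt x) \<partial>lborel)"
    unfolding 1 unfolding C_def qam_constellation_eq
    by (subst sum.reindex) (auto simp: inj_on_qam_point dpos intro!: sum.cong)
  also have "\<dots> = (\<Sum>n<MI. \<Sum>q<MQ. \<integral>\<^sup>+x. ?e x * ennreal (pam_correct (sqrt v) MI (?c x) n * pam_correct (sqrt v) MQ (?c x) q) \<partial>lborel)"
    by (simp add: sum.cartesian_product[symmetric] 2)
  also have "\<dots> = ennreal (real MI * real MQ * (1 - qam_error MI MQ (qam_beta MI MQ P0 v)))"
    by (rule rayleigh_qam_correct(1)[OF qam v])
  finally show ?thesis .
qed

subsection \<open>Symbol error probability\<close>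

lemma card_qam_constellation:
  assumes "0 < qam_dmin MI MQ P0"
  shows "card (qam_constellation MI MQ P0) = MI * MQ"
  unfolding qam_constellation_eq by (simp add: card_image inj_on_qam_point assms)

text \<open>Cell integrals are linear in the density, so each mixture component contributes with its
  own variance. As the weights sum to 1, averaging the correct-decision probabilities is averaging
  the errors.\<close>

lemma (in osa_state) prob_error:
  assumes qam: "1 \<le> MI" "1 \<le> MQ" "2 \<le> MI * MQ" "0 < P0"
    and Rayleigh: "distributed M lborel (\<lambda>\<omega>. (cmod (h \<omega>))\<^sup>2) (\<lambda>x. ennreal (exponential_density 1 x))"
    and uniform: "\<And>s. s \<in> qam_constellation MI MQ P0 \<Longrightarrow> \<P>(\<omega> in N. S \<omega> = s) = 1 / (real MI * real MQ)"
    and D_measurable [measurable]: "(\<lambda>(h, y). D h y) \<in> borel_measurable (borel \<Otimes>\<^sub>M borel)"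
    and D: "AE g in H. AE y in lborel. \<forall>s\<in>qam_constellation MI MQ P0.
      D g y = s \<longleftrightarrow> (\<forall>s'\<in>qam_constellation MI MQ P0. cmod (y - g * s) \<le> cmod (y - g * s'))"
    and mixture: "\<And>z. k z = (\<Sum>l\<in>L. a l * cgauss_density (v l) z)"
    and L: "finite L" "\<And>l. l \<in> L \<Longrightarrow> 0 < v l" "\<And>l. l \<in> L \<Longrightarrow> 0 \<le> a l" "(\<Sum>l\<in>L. a l) = 1"
  shows "\<P>(\<omega> in N. D (h \<omega>) (osa_received state decision S h n w \<omega>) \<noteq> S \<omega>)
    = (\<Sum>l\<in>L. a l * qam_error MI MQ (qam_beta MI MQ P0 (v l)))"
proof -
  interpret N: prob_space N by (rule prob_space_N)
  define C where "C = qam_constellation MI MQ P0"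
  define e where "e l = qam_error MI MQ (qam_beta MI MQ P0 (v l))" for l
  have card: "card C = MI * MQ"
    unfolding C_def by (intro card_qam_constellation qam_dmin_pos(2) qam)
  have m: "0 < real MI * real MQ" using qam by simp
  have C: "finite C" "C \<noteq> {}"
    using card qam(3) by (auto simp: C_def qam_constellation_eq)
  have [measurable]: "(\<lambda>\<omega>. D (h \<omega>) (osa_received state decision S h n w \<omega>)) \<in> borel_measurable M"
    using measurable_compose[OF measurable_Pair[OF measurable_fading measurable_received] D_measurable] by simp
  have "emeasure N {\<omega> \<in> space N. D (h \<omega>) (osa_received state decision S h n w \<omega>) = S \<omega>}
    = ennreal (1 / real (card C)) * (\<Sum>s\<in>C. \<integral>\<^sup>+g. \<integral>\<^sup>+z. ennreal (k z) * indicator (nearest_region C g s) z \<partial>lborel \<partial>H)"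
    using C uniform D unfolding C_def[symmetric] by (intro prob_correct D_measurable) (simp_all add: card)
  also have "(\<Sum>s\<in>C. \<integral>\<^sup>+g. \<integral>\<^sup>+z. ennreal (k z) * indicator (nearest_region C g s) z \<partial>lborel \<partial>H)
    = (\<Sum>s\<in>C. \<Sum>l\<in>L. ennreal (a l) * (\<integral>\<^sup>+g. \<integral>\<^sup>+z. ennreal (cgauss_density (v l) z) * indicator (nearest_region C g s) z \<partial>lborel \<partial>H))"
  proof (rule sum.cong[OF refl])
    fix s
    have "ennreal (k z) = (\<Sum>l\<in>L. ennreal (a l) * ennreal (cgauss_density (v l) z))" for z
      unfolding mixture using L(2,3)
      by (subst sum_ennreal[symmetric]) (auto simp: ennreal_mult cgauss_density_nonneg intro!: sum.cong)
    then have "(\<integral>\<^sup>+g. \<integral>\<^sup>+z. ennreal (k z) * indicator (nearest_region C g s) z \<partial>lborel \<partial>H)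
      = (\<integral>\<^sup>+g. \<integral>\<^sup>+z. (\<Sum>l\<in>L. ennreal (a l) * (ennreal (cgauss_density (v l) z) * indicator (nearest_region C g s) z)) \<partial>lborel \<partial>H)"
      by (simp add: sum_distrib_right mult.assoc)
    also have "\<dots> = (\<integral>\<^sup>+g. (\<Sum>l\<in>L. ennreal (a l) * (\<integral>\<^sup>+z. ennreal (cgauss_density (v l) z) * indicator (nearest_region C g s) z \<partial>lborel)) \<partial>H)"
      by (simp add: nn_integral_sum nn_integral_cmult)
    also have "\<dots> = (\<Sum>l\<in>L. ennreal (a l) * (\<integral>\<^sup>+g. \<integral>\<^sup>+z. ennreal (cgauss_density (v l) z) * indicator (nearest_region C g s) z \<partial>lborel \<partial>H))"
      using C(1) by (simp add: nn_integral_sum nn_integral_cmult)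
    finally show "(\<integral>\<^sup>+g. \<integral>\<^sup>+z. ennreal (k z) * indicator (nearest_region C g s) z \<partial>lborel \<partial>H) = \<dots>" .
  qed
  also have "\<dots> = (\<Sum>l\<in>L. ennreal (a l) * (\<Sum>s\<in>C. \<integral>\<^sup>+g. \<integral>\<^sup>+z. ennreal (cgauss_density (v l) z) * indicator (nearest_region C g s) z \<partial>lborel \<partial>H))"
    by (subst sum.swap) (simp add: sum_distrib_left)
  also have "\<dots> = (\<Sum>l\<in>L. ennreal (a l * (real MI * real MQ * (1 - e l))))"
    unfolding C_def e_def
    by (intro sum.cong refl, subst rayleigh_nearest_region[OF prob_space_axioms measurable_fading Rayleigh qam])
       (use L in \<open>auto simp: ennreal_mult'\<close>)
  also have "\<dots> = ennreal (\<Sum>l\<in>L. a l * (real MI * real MQ * (1 - e l)))"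
    unfolding e_def using L m rayleigh_qam_correct(2)[OF qam] by (intro sum_ennreal mult_nonneg_nonneg) auto
  also have "(\<Sum>l\<in>L. a l * (real MI * real MQ * (1 - e l))) = real MI * real MQ * (\<Sum>l\<in>L. a l * (1 - e l))"
    by (simp add: sum_distrib_left ac_simps)
  also have "(\<Sum>l\<in>L. a l * (1 - e l)) = 1 - (\<Sum>l\<in>L. a l * e l)"
    by (simp add: right_diff_distrib sum_subtractf L(4))
  also have "ennreal (1 / real (card C)) * ennreal (real MI * real MQ * (1 - (\<Sum>l\<in>L. a l * e l))) = ennreal (1 - (\<Sum>l\<in>L. a l * e l))"
  proof -
    have "MI \<noteq> 0" "MQ \<noteq> 0" using qam(1,2) by auto
    then show ?thesis by (simp add: ennreal_mult'[symmetric] card)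
  qed
  finally have "emeasure N {\<omega> \<in> space N. D (h \<omega>) (osa_received state decision S h n w \<omega>) = S \<omega>} = ennreal (1 - (\<Sum>l\<in>L. a l * e l))" .
  moreover have "0 \<le> 1 - (\<Sum>l\<in>L. a l * e l)"
  proof -
    have "0 \<le> (\<Sum>l\<in>L. a l * (1 - e l))"
      unfolding e_def using L rayleigh_qam_correct(2)[OF qam] by (intro sum_nonneg mult_nonneg_nonneg) auto
    then show ?thesis by (simp add: right_diff_distrib sum_subtractf L(4))
  qed
  ultimately have "\<P>(\<omega> in N. D (h \<omega>) (osa_received state decision S h n w \<omega>) = S \<omega>) = 1 - (\<Sum>l\<in>L. a l * e l)"
    by (simp add: N.emeasure_eq_measure)
  moreover have "\<P>(\<omega> in N. D (h \<omega>) (osa_received state decision S h n w \<omega>) \<noteq> S \<omega>)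
      = 1 - \<P>(\<omega> in N. D (h \<omega>) (osa_received state decision S h n w \<omega>) = S \<omega>)"
    by (rule N.prob_neg) measurable
  ultimately show ?thesis by (simp add: e_def)
qed

lemma cgauss_density_strict_decreasing:
  assumes "0 < v" "0 \<le> a" "a < b"
  shows "cgauss_density v (of_real b) < cgauss_density v (of_real a)"
proof -
  have "a\<^sup>2 < b\<^sup>2" using assms by (intro power_strict_mono) auto
  then show ?thesis using assms by (simp add: cgauss_density_def divide_strict_right_mono)
qed

text \<open>Weights with sum 1 cannot all vanish; a component of positive weight supplies the
  strictness.\<close>

lemma cgauss_mixture_strict_decreasing:
  assumes L: "finite L" "\<And>l. l \<in> L \<Longrightarrow> 0 < v l" "\<And>l. l \<in> L \<Longrightarrow> 0 \<le> c l" "(\<Sum>l\<in>L. c l) = (1::real)"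
    and "0 \<le> a" "a < b"
  shows "(\<Sum>l\<in>L. c l * cgauss_density (v l) (of_real b)) < (\<Sum>l\<in>L. c l * cgauss_density (v l) (of_real a))"
proof (rule sum_strict_mono_ex1)
  have "\<exists>l\<in>L. c l \<noteq> 0" using L(4) by (metis sum.neutral zero_neq_one)
  then show "\<exists>l\<in>L. c l * cgauss_density (v l) (of_real b) < c l * cgauss_density (v l) (of_real a)"
    using L cgauss_density_strict_decreasing assms(5,6) by (metis less_eq_real_def mult_strict_left_mono)
  show "\<forall>l\<in>L. c l * cgauss_density (v l) (of_real b) \<le> c l * cgauss_density (v l) (of_real a)"
    using L(2,3) cgauss_density_strict_decreasing[OF _ assms(5,6)]
    by (intro ballI mult_left_mono) (auto intro: less_imp_le)
qed (fact L(1))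

theorem mainTheorem4:
  fixes M :: "'a measure"
    and state decision :: "'a \<Rightarrow> channel"
    and S h n w :: "'a \<Rightarrow> complex"
    and MI MQ p :: nat
    and P0 \<sigma>n :: real
    and lam \<sigma> :: "nat \<Rightarrow> real"
    and f :: "channel \<Rightarrow> complex \<Rightarrow> complex \<Rightarrow> complex \<Rightarrow> real"
    and D :: "complex \<Rightarrow> complex \<Rightarrow> complex"
  defines "C \<equiv> qam_constellation MI MQ P0"
    and "N \<equiv> given_idle M state decision"
    and "post \<equiv> posterior M state decision"
    and "\<beta>0 \<equiv> qam_beta MI MQ P0 (\<sigma>n\<^sup>2)"
    and "\<beta>1 \<equiv> (\<lambda>l. qam_beta MI MQ P0 ((\<sigma> l)\<^sup>2 + \<sigma>n\<^sup>2))"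
  assumes "prob_space M"
    and "state \<in> measurable M (count_space UNIV)" "decision \<in> measurable M (count_space UNIV)"
    and "S \<in> borel_measurable M" "h \<in> borel_measurable M"
    and "n \<in> borel_measurable M" "w \<in> borel_measurable M"
    and "1 \<le> MI" "1 \<le> MQ" "2 \<le> MI * MQ" "0 < P0"
    and "0 < \<sigma>n\<^sup>2" "\<And>l. l \<in> {1..p} \<Longrightarrow> 0 < (\<sigma> l)\<^sup>2"
    and "\<And>l. l \<in> {1..p} \<Longrightarrow> 0 \<le> lam l" "(\<Sum>l=1..p. lam l) = 1"
    and idle_decision: "0 < \<P>(\<omega> in M. decision \<omega> = Idle)"
    and uniform_symbol:
      "\<And>j s. 0 < \<P>(\<omega> in M. decision \<omega> = Idle \<and> state \<omega> = j) \<Longrightarrow> s \<in> C \<Longrightarrow>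
         \<P>(\<omega> in N j. S \<omega> = s) = 1 / (real MI * real MQ)"
    and noise:
      "\<And>j. 0 < \<P>(\<omega> in M. decision \<omega> = Idle \<and> state \<omega> = j) \<Longrightarrow>
         distributed (N j) lborel n (\<lambda>z. ennreal (cgauss_density (\<sigma>n\<^sup>2) z))"
    and interference:
      "0 < \<P>(\<omega> in M. decision \<omega> = Idle \<and> state \<omega> = Busy) \<Longrightarrow>
         distributed (N Busy) lborel w (\<lambda>z. ennreal (cgauss_mixture_density p lam \<sigma> z))"
    and noise_indep_interference:
      "\<And>j. 0 < \<P>(\<omega> in M. decision \<omega> = Idle \<and> state \<omega> = j) \<Longrightarrow>
         prob_space.indep_var (N j) borel n borel w"
    and symbol_indep_disturbance:
      "\<And>j. 0 < \<P>(\<omega> in M. decision \<omega> = Idle \<and> state \<omega> = j) \<Longrightarrow>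
         indep_rv (N j) borel S (borel \<Otimes>\<^sub>M borel) (\<lambda>\<omega>. (n \<omega>, w \<omega>))"
    and fading_indep:
      "indep_rv M borel h
         (count_space UNIV \<Otimes>\<^sub>M count_space UNIV \<Otimes>\<^sub>M borel \<Otimes>\<^sub>M borel \<Otimes>\<^sub>M borel)
         (\<lambda>\<omega>. (state \<omega>, decision \<omega>, S \<omega>, n \<omega>, w \<omega>))"
    and Rayleigh:
      "distributed M lborel (\<lambda>\<omega>. (cmod (h \<omega>))\<^sup>2) (\<lambda>x. ennreal (exponential_density 1 x))"
    and cond_density:
      "\<And>j. 0 < \<P>(\<omega> in M. decision \<omega> = Idle \<and> state \<omega> = j) \<Longrightarrow>
         has_cond_density (N j) (borel \<Otimes>\<^sub>M borel) (\<lambda>\<omega>. (S \<omega>, h \<omega>))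
           lborel (osa_received state decision S h n w) (\<lambda>(s, g) y. f j s g y)"
    and detector: "is_map_detector C post f D"
  shows "osa_sep M state decision S h n w D =
      post Idle *
        ((2 - 1 / real MI - 1 / real MQ) * (1 - 1 / \<beta>0)
         - 2 * (1 - 1 / real MI) * (1 - 1 / real MQ) *
             (2 / pi * (1 / \<beta>0) * arctan (1 / \<beta>0) - 1 / \<beta>0 + 1 / 2))
    + post Busy *
        ((2 - 1 / real MI - 1 / real MQ) * (\<Sum>l=1..p. lam l * (1 - 1 / \<beta>1 l))
         - 2 * (1 - 1 / real MI) * (1 - 1 / real MQ) *
             (\<Sum>l=1..p. lam l *
               (2 / pi * (1 / \<beta>1 l) * arctan (1 / \<beta>1 l) - 1 / \<beta>1 l + 1 / 2)))"
proof -
  interpret M: prob_space M by fact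
  note [measurable] = assms(7-12)
  note qam = assms(13-16)
  have \<sigma>n: "0 < \<sigma>n\<^sup>2" and \<sigma>: "\<And>l. l \<in> {1..p} \<Longrightarrow> 0 < (\<sigma> l)\<^sup>2"
    and lam: "\<And>l. l \<in> {1..p} \<Longrightarrow> 0 \<le> lam l" "(\<Sum>l=1..p. lam l) = 1"
    by (fact assms)+
  define J where "J j = \<P>(\<omega> in M. decision \<omega> = Idle \<and> state \<omega> = j)" for j
  \<comment> \<open>The idle state is cast as a mixture with the single index 0 and weight 1, so
    that \<open>prob_error\<close> applies to both states.\<close>
  define L where "L j = (case j of Idle \<Rightarrow> {0} | Busy \<Rightarrow> {1..p})" for j
  define a where "a j = (case j of Idle \<Rightarrow> \<lambda>_. 1 | Busy \<Rightarrow> lam)" for j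
  define v where "v j = (case j of Idle \<Rightarrow> \<lambda>_. \<sigma>n\<^sup>2 | Busy \<Rightarrow> \<lambda>l. (\<sigma> l)\<^sup>2 + \<sigma>n\<^sup>2)" for j
  define k where "k j z = (\<Sum>l\<in>L j. a j l * cgauss_density (v j l) z)" for j z
  have L: "finite (L j)" "\<And>l. l \<in> L j \<Longrightarrow> 0 < v j l" "\<And>l. l \<in> L j \<Longrightarrow> 0 \<le> a j l" "(\<Sum>l\<in>L j. a j l) = 1" for j
    using \<sigma>n \<sigma> lam by (cases j; auto simp: L_def a_def v_def intro!: add_pos_pos)+
  have km [measurable]: "k j \<in> borel_measurable borel" for j
    unfolding k_def by measurable
  have k0: "0 \<le> k j z" for j z
    unfolding k_def using L by (intro sum_nonneg mult_nonneg_nonneg cgauss_density_nonneg) auto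
  have k_decreasing: "k j (of_real y) < k j (of_real x)" if "0 \<le> x" "x < y" for j x y
    unfolding k_def by (rule cgauss_mixture_strict_decreasing) (use L that in auto)
  have k_radial: "k j z = k j (of_real (cmod z))" for j z
    unfolding k_def by (subst cgauss_density_radial) simp
  have dist: "distributed (N j) lborel (disturbance j n w) (\<lambda>z. ennreal (k j z))" if j: "0 < J j" for j
  proof (cases j)
    case Idle
    have "disturbance Idle n w = n" by (simp add: fun_eq_iff disturbance_def)
    then show ?thesis
      using noise[of j] j by (simp add: Idle J_def k_def L_def a_def v_def)
  next
    case Busy
    have "prob_space (N Busy)"
      unfolding N_def given_idle_def using j
      by (intro prob_space_uniform_measure) (simp_all add: M.emeasure_eq_measure J_def Busy)
    then have "distributed (N Busy) lborel (\<lambda>\<omega>. n \<omega> + w \<omega>) (\<lambda>z. ennreal (k Busy z))"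
      using noise[of Busy] interference noise_indep_interference[of Busy] j
        cgauss_mixture_convolution[of "\<sigma>n\<^sup>2" p \<sigma> lam] \<sigma>n \<sigma> lam
      by (intro prob_space.distributed_add_indep) (simp_all add: Busy J_def k_def L_def a_def v_def)
    moreover have "disturbance Busy n w = (\<lambda>\<omega>. n \<omega> + w \<omega>)" by (simp add: fun_eq_iff disturbance_def)
    ultimately show ?thesis by (simp add: Busy)
  qed
  have osa: "osa_state M state decision S h n w j (k j)" if j: "0 < J j" for j
    using j symbol_indep_disturbance[of j] fading_indep dist[OF j] k0
    unfolding osa_state_def osa_state_axioms_def N_def J_def
    by (simp add: M.prob_space_axioms)

  have post_eq: "post j = J j / \<P>(\<omega> in M. decision \<omega> = Idle)" for j
    by (simp add: post_def posterior_def cond_prob_def J_def conj_commute)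
  have J0: "0 \<le> J j" for j by (simp add: J_def)
  have post0: "0 \<le> post j" for j unfolding post_eq using J0 idle_decision by simp
  have J_sum: "J Idle + J Busy = \<P>(\<omega> in M. decision \<omega> = Idle)"
    unfolding J_def
    by (subst M.finite_measure_Union[symmetric]) (auto intro!: arg_cong[where f = M.prob] intro: channel.exhaust)
  then have post_sum: "post Idle + post Busy = 1"
    unfolding post_eq using idle_decision by (simp add: add_divide_distrib[symmetric])

  have dpos: "0 < qam_dmin MI MQ P0" by (rule qam_dmin_pos(2)[OF qam])
  have C: "finite C" by (simp add: C_def qam_constellation_eq)
  \<comment> \<open>|h|^2 has a density, so 0 carries no mass; at \<open>g = 0\<close> the symbols
    would be indistinguishable.\<close>
  have H_nonzero: "AE g in distr M borel h. g \<noteq> 0"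
  proof -
    have "emeasure M ((\<lambda>\<omega>. (cmod (h \<omega>))\<^sup>2) -` {0} \<inter> space M) = 0"
      by (subst distributed_emeasure[OF Rayleigh]) (simp_all add: nn_integral_indicator_singleton)
    then have "AE \<omega> in M. h \<omega> \<noteq> 0"
    proof (subst AE_iff_measurable[OF _ refl])
      show "{\<omega> \<in> space M. \<not> h \<omega> \<noteq> 0} \<in> sets M" by measurable
    qed (simp add: vimage_def Int_def conj_commute)
    then show ?thesis
      by (subst AE_distr_iff) simp_all
  qed
  \<comment> \<open>The factor \<open>post j\<close> covers a state of probability zero, for which
    nothing is known about \<open>f j\<close>.\<close>
  have density: "AE g in distr M borel h. AE y in lborel. post j * f j s g y = post j * k j (y - g * s)" if "s \<in> C" for j s
  proof (cases "0 < J j")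
    case True
    then interpret osa_state M state decision S h n w j "k j" by (rule osa)
    have "AE g in distr M borel h. AE y in lborel. f j s g y = k j (y - g * s)"
      using True cond_density[of j] uniform_symbol[of j s] that qam
      by (intro cond_density_eq_AE) (simp_all add: N_def J_def)
    then show ?thesis by (auto elim: AE_mp)
  next
    case False
    then have "post j = 0" using J0[of j] by (simp add: post_eq)
    then show ?thesis by simp
  qed
  define \<Phi> where "\<Phi> r = post Idle * k Idle (of_real r) + post Busy * k Busy (of_real r)" for r :: real
  \<comment> \<open>The posterior weights are nonnegative with sum 1, so one of them is positive and
    makes the inequality strict.\<close>
  have \<Phi>: "\<Phi> y < \<Phi> x" if "0 \<le> x" "x < y" for x y
  proof -
    have le: "post j * k j (of_real y) \<le> post j * k j (of_real x)" for j
      by (rule mult_left_mono[OF less_imp_le[OF k_decreasing[OF that]] post0])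
    have less: "post j * k j (of_real y) < post j * k j (of_real x)" if "0 < post j" for j
      by (rule mult_strict_left_mono[OF k_decreasing[OF \<open>0 \<le> x\<close> \<open>x < y\<close>] that])
    have "0 < post Idle \<or> 0 < post Busy" using post_sum by linarith
    then show ?thesis
      unfolding \<Phi>_def using le less by (auto intro: add_less_le_mono add_le_less_mono)
  qed
  have "AE g in distr M borel h. AE y in lborel. \<forall>s\<in>C. post Idle * f Idle s g y + post Busy * f Busy s g y = \<Phi> (cmod (y - g * s))"
  proof -
    \<comment> \<open>The exceptional sets may depend on \<open>s\<close>; finiteness of
      \<open>C\<close> lets the quantifier pass inside both almost-everywhere statements.\<close>
    have "AE g in distr M borel h. \<forall>s\<in>C. AE y in lborel. post Idle * f Idle s g y + post Busy * f Busy s g y = \<Phi> (cmod (y - g * s))"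
      unfolding AE_finite_all[OF C]
    proof
      fix s assume "s \<in> C"
      show "AE g in distr M borel h. AE y in lborel. post Idle * f Idle s g y + post Busy * f Busy s g y = \<Phi> (cmod (y - g * s))"
        using density[OF \<open>s \<in> C\<close>, of Idle] density[OF \<open>s \<in> C\<close>, of Busy]
      proof eventually_elim
        case (elim g)
        then show ?case
        proof eventually_elim
          case (elim y)
          then show ?case
            unfolding \<Phi>_def k_radial[symmetric] by (simp only:)
        qed
      qed
    qed
    then show ?thesis by (simp add: AE_finite_all[OF C])
  qed
  with H_nonzero have nearest: "AE g in distr M borel h. AE y in lborel. \<forall>s\<in>C. D g y = s \<longleftrightarrow> (\<forall>s'\<in>C. cmod (y - g * s) \<le> cmod (y - g * s'))"
  proof eventually_elim
    case (elim g)
    then show ?case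
      by (intro map_detector_nearest[OF C detector, where \<Phi>=\<Phi>] \<Phi>) auto
  qed

  have D_measurable: "(\<lambda>(h, y). D h y) \<in> borel_measurable (borel \<Otimes>\<^sub>M borel)"
    using detector by (simp add: is_map_detector_def)
  let ?Y = "osa_received state decision S h n w"
  have [measurable]: "?Y \<in> borel_measurable M" unfolding osa_received_def by measurable
  have DY [measurable]: "(\<lambda>\<omega>. D (h \<omega>) (?Y \<omega>)) \<in> borel_measurable M"
    using measurable_compose[OF _ D_measurable, of "\<lambda>\<omega>. (h \<omega>, ?Y \<omega>)" M] by simp
  define e where "e j = (\<Sum>l\<in>L j. a j l * qam_error MI MQ (qam_beta MI MQ P0 (v j l)))" for j
  \<comment> \<open>Undoes the conditioning; for \<open>J j = 0\<close> both sides vanish, the left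
    one by monotonicity.\<close>
  have joint: "\<P>(\<omega> in M. D (h \<omega>) (?Y \<omega>) \<noteq> S \<omega> \<and> decision \<omega> = Idle \<and> state \<omega> = j) = J j * e j" for j
  proof (cases "0 < J j")
    case True
    then interpret osa_state M state decision S h n w j "k j" by (rule osa)
    have "\<P>(\<omega> in given_idle M state decision j. D (h \<omega>) (?Y \<omega>) \<noteq> S \<omega>) = e j"
      unfolding e_def
    proof (rule prob_error[OF qam Rayleigh _ D_measurable])
      show "\<P>(\<omega> in given_idle M state decision j. S \<omega> = s) = 1 / (real MI * real MQ)" if "s \<in> qam_constellation MI MQ P0" for s
        using uniform_symbol[of j s] that True by (simp add: N_def C_def J_def)
    qed (use nearest L in \<open>simp_all add: C_def k_def\<close>)
    moreover have "\<P>(\<omega> in given_idle M state decision j. D (h \<omega>) (?Y \<omega>) \<noteq> S \<omega>)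
        = \<P>(\<omega> in M. D (h \<omega>) (?Y \<omega>) \<noteq> S \<omega> \<bar> decision \<omega> = Idle \<and> state \<omega> = j)"
      unfolding given_idle_def by (rule M.measure_uniform_measure_eq_cond_prob) measurable
    ultimately show ?thesis
      using True by (simp add: cond_prob_def J_def field_simps)
  next
    case False
    then have "J j = 0" using J0[of j] by simp
    moreover have "\<P>(\<omega> in M. D (h \<omega>) (?Y \<omega>) \<noteq> S \<omega> \<and> decision \<omega> = Idle \<and> state \<omega> = j) \<le> J j"
      unfolding J_def by (intro M.finite_measure_mono) auto
    ultimately show ?thesis by (simp add: order_antisym)
  qed
  \<comment> \<open>Total probability over the true state; division by the probability of an idle
    decision turns each \<open>J j\<close> into \<open>post j\<close>.\<close>
  have "\<P>(\<omega> in M. D (h \<omega>) (?Y \<omega>) \<noteq> S \<omega> \<and> decision \<omega> = Idle)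
      = \<P>(\<omega> in M. D (h \<omega>) (?Y \<omega>) \<noteq> S \<omega> \<and> decision \<omega> = Idle \<and> state \<omega> = Idle)
      + \<P>(\<omega> in M. D (h \<omega>) (?Y \<omega>) \<noteq> S \<omega> \<and> decision \<omega> = Idle \<and> state \<omega> = Busy)"
    by (subst M.finite_measure_Union[symmetric]) (auto intro!: arg_cong[where f = M.prob] intro: channel.exhaust)
  then have "osa_sep M state decision S h n w D = post Idle * e Idle + post Busy * e Busy"
    unfolding joint osa_sep_def cond_prob_def post_eq by (simp add: add_divide_distrib)
  moreover have "e Idle = qam_error MI MQ \<beta>0"
    by (simp add: e_def L_def a_def v_def \<beta>0_def)
  \<comment> \<open>\<open>qam_error\<close> is linear in its two \<beta>-dependent terms, so the
    weighted sum passes into each of them.\<close>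
  moreover have "e Busy = (2 - 1 / real MI - 1 / real MQ) * (\<Sum>l=1..p. lam l * (1 - 1 / \<beta>1 l))
         - 2 * (1 - 1 / real MI) * (1 - 1 / real MQ) *
             (\<Sum>l=1..p. lam l *
               (2 / pi * (1 / \<beta>1 l) * arctan (1 / \<beta>1 l) - 1 / \<beta>1 l + 1 / 2))"
    unfolding e_def qam_error_def sum_distrib_left sum_subtractf[symmetric]
    by (simp add: L_def a_def v_def \<beta>1_def) (intro sum.cong refl, simp add: algebra_simps)
  ultimately show ?thesis by (simp only: qam_error_def)
qed

end
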